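(* For any nonzero function $f \in L_2(\mathbb{R}_+)$, the following inequality holds: $$UC_d(f) \ge C, \quad \text{where } C \simeq 8.5 \times 10^{-5}.$$ Here $C$ is an absolute constant (independent of $f$), and $\simeq$ means approximate equality: $8.5\times 10^{-5}$ is only a rounded numerical value of $C$.
   Context: Notation: $\mathbb{R}_+ = [0,\infty)$; functions are complex valued. Every $x \in \mathbb{R}_+$ is written in its dyadic expansion $x = \sum_{j\in\mathbb{Z}} x_j 2^{-j-1}$ with $x_j \in \{0,1\}$; when two expansions exist (dyadic rationals), the one terminating in $0$'s is chosen, i.e. $x_j = 0$ for all large $j$. Dyadic sum: $x \oplus y := \sum_{j \in \mathbb{Z}} |x_j - y_j| 2^{-j-1}$. Walsh-Fourier transform: with $\mathrm{w}(t,x) := (-1)^{\sum_{j\in\mathbb{Z}} t_j x_{-j-1}}$, for $f \in L_1(\mathbb{R}_+)$ put $\widehat{f}(t) := \int_{\mathbb{R}_+} f(x)\,\mathrm{w}(t,x)\,dx$, extended to $L_2(\mathbb{R}_+)$ in the standard way by the Plancherel theorem. Dyadic uncertainty constant: for nonzero $g\in L_2(\mathbb{R}_+)$ let $$V(g) := \frac{1}{\|g\|^2_{L_2(\mathbb{R}_+)}} \min_{\tilde{x}\in\mathbb{R}_+} \int_{\mathbb{R}_+} (x \oplus \tilde{x})^2 |g(x)|^2\,dx \in (0,+\infty],$$ with value $+\infty$ if all these integrals are infinite. Then $UC_d(f) := V(f)\,V(\widehat{f})$, where $V(\widehat f)$ is $V$ applied to $\widehat f$. *)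

theory Defs
  imports "HOL-Analysis.Analysis"
begin

text \<open>
  The digit \<open>x\<^sub>j\<close> of \<open>x \<ge> 0\<close> carries the weight \<open>2\<^bsup>-j-1\<^esup>\<close>.  The floor formula selects, at dyadic
  rationals, the expansion that terminates in zeros; see \<open>dyadic_digit_has_sum\<close> and
  \<open>dyadic_digit_zero_infinitely_often\<close>.
\<close>

definition dyadic_digit :: "real \<Rightarrow> int \<Rightarrow> nat" where
  "dyadic_digit x j = nat (\<lfloor>x * 2 powi (j + 1)\<rfloor> mod 2)"

definition dyadic_sum :: "real \<Rightarrow> real \<Rightarrow> real"  (infixl "\<oplus>" 65) where
  "x \<oplus> y = (\<Sum>\<^sub>\<infinity>j\<in>UNIV. \<bar>real (dyadic_digit x j) - real (dyadic_digit y j)\<bar> * 2 powi (- j - 1))"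

text \<open>The exponent has only finitely many nonzero terms, by \<open>finite_walsh_support\<close>.\<close>

definition walsh :: "real \<Rightarrow> real \<Rightarrow> real" where
  "walsh t x =
     (- 1) ^ (\<Sum>j | dyadic_digit t j * dyadic_digit x (- j - 1) \<noteq> 0.
                dyadic_digit t j * dyadic_digit x (- j - 1))"

abbreviation Rplus :: "real measure" where
  "Rplus \<equiv> lebesgue_on {0..}"

definition L2_norm_sq :: "(real \<Rightarrow> complex) \<Rightarrow> ennreal" where
  "L2_norm_sq f = (\<integral>\<^sup>+ x. ennreal ((cmod (f x))\<^sup>2) \<partial>Rplus)"

definition in_L2 :: "(real \<Rightarrow> complex) \<Rightarrow> bool" where
  "in_L2 f \<longleftrightarrow> f \<in> borel_measurable Rplus \<and> integrable Rplus (\<lambda>x. (cmod (f x))\<^sup>2)"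

definition walsh_fourier_L1 :: "(real \<Rightarrow> complex) \<Rightarrow> real \<Rightarrow> complex" where
  "walsh_fourier_L1 f t = (LINT x|Rplus. f x * complex_of_real (walsh t x))"

text \<open>
  The graph of the continuous extension to \<open>L\<^sub>2\<close>: the \<open>L\<^sub>2 \<times> L\<^sub>2\<close> closure of the graph of the
  transform on \<open>L\<^sub>1 \<inter> L\<^sub>2\<close>.  By Plancherel's theorem this determines \<open>g\<close> up to null sets, and
  changing \<open>g\<close> on a null set does not affect \<open>dyadic_variance g\<close>.
\<close>

definition is_walsh_fourier :: "(real \<Rightarrow> complex) \<Rightarrow> (real \<Rightarrow> complex) \<Rightarrow> bool" where
  "is_walsh_fourier f g \<longleftrightarrow> in_L2 g \<and>
     (\<exists>F. (\<forall>n. integrable Rplus (F n) \<and> in_L2 (F n)) \<and>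
          (\<lambda>n. L2_norm_sq (\<lambda>x. F n x - f x)) \<longlonglongrightarrow> 0 \<and>
          (\<lambda>n. L2_norm_sq (\<lambda>t. walsh_fourier_L1 (F n) t - g t)) \<longlonglongrightarrow> 0)"

definition walsh_fourier :: "(real \<Rightarrow> complex) \<Rightarrow> real \<Rightarrow> complex" where
  "walsh_fourier f = (SOME g. is_walsh_fourier f g)"

text \<open>
  An infimum rather than a minimum: expansions ending in ones are limits of points of the
  half-line in the dyadic metric but do not occur as dyadic digits of a real number, so a
  minimiser \<open>y\<close> may be missing.
\<close>

definition dyadic_variance :: "(real \<Rightarrow> complex) \<Rightarrow> ennreal" where
  "dyadic_variance g =
     (INF y\<in>{0..}. \<integral>\<^sup>+ x. ennreal ((x \<oplus> y)\<^sup>2 * (cmod (g x))\<^sup>2) \<partial>Rplus) / L2_norm_sq g"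

definition UC_d :: "(real \<Rightarrow> complex) \<Rightarrow> ennreal" where
  "UC_d f = dyadic_variance f * dyadic_variance (walsh_fourier f)"


lemma dyadic_digit_le_1: "dyadic_digit x j \<le> 1"
  unfolding dyadic_digit_def by linarith

lemma dyadic_digit_step:
  "real (dyadic_digit x j) * 2 powi (- j - 1) =
     real_of_int \<lfloor>x * 2 powi (j + 1)\<rfloor> * 2 powi (- j - 1) - real_of_int \<lfloor>x * 2 powi j\<rfloor> * 2 powi (- j)"
proof -
  define y where "y = x * 2 powi j"
  have y2: "x * 2 powi (j + 1) = 2 * y"
    by (simp add: y_def power_int_add)
  have "\<lfloor>2 * y\<rfloor> div 2 = \<lfloor>y\<rfloor>"
    by linarith
  then have d: "\<lfloor>2 * y\<rfloor> mod 2 = \<lfloor>2 * y\<rfloor> - 2 * \<lfloor>y\<rfloor>"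
    by presburger
  have "\<lfloor>2 * y\<rfloor> mod 2 \<ge> 0"
    by simp
  then have r: "real (dyadic_digit x j) = real_of_int \<lfloor>2 * y\<rfloor> - 2 * real_of_int \<lfloor>y\<rfloor>"
    unfolding dyadic_digit_def y2 using d by simp
  have p: "(2::real) powi (- j) = 2 * 2 powi (- j - 1)"
    using power_int_add_1'[of "2::real" "- j - 1"] by simp
  show ?thesis
    unfolding r y2 p y_def[symmetric] by (simp add: algebra_simps)
qed

lemma dyadic_digit_partial_sum:
  "(\<Sum>j\<in>{- int n..<int n}. real (dyadic_digit x j) * 2 powi (- j - 1)) =
     real_of_int \<lfloor>x * 2 ^ n\<rfloor> / 2 ^ n - real_of_int \<lfloor>x / 2 ^ n\<rfloor> * 2 ^ n"
proof -
  define G where "G j = real_of_int \<lfloor>x * 2 powi j\<rfloor> * 2 powi (- j)" for j :: int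
  have "(\<Sum>j\<in>{- int n..<- int n + int k}. real (dyadic_digit x j) * 2 powi (- j - 1)) =
          G (- int n + int k) - G (- int n)" for k
  proof (induction k)
    case (Suc k)
    have "{- int n..<- int n + int (Suc k)} = insert (- int n + int k) {- int n..<- int n + int k}"
      by auto
    then show ?case
      using Suc dyadic_digit_step[of x "- int n + int k"] by (simp add: G_def algebra_simps)
  qed simp
  from this[of "2 * n"] show ?thesis
    by (simp add: G_def power_int_minus divide_inverse)
qed

theorem dyadic_digit_has_sum:
  assumes "x \<ge> 0"
  shows "((\<lambda>j. real (dyadic_digit x j) * 2 powi (- j - 1)) has_sum x) UNIV"
proof -
  let ?f = "\<lambda>j. real (dyadic_digit x j) * 2 powi (- j - 1)"
  have f0: "?f j \<ge> 0" for j
    by simp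
  define S where "S n = sum ?f {- int n..<int n}" for n
  have lo: "x - S n \<le> 1 / 2 ^ n" if "x < 2 ^ n" for n
  proof -
    have "\<lfloor>x / 2 ^ n\<rfloor> = 0"
      using that assms by (simp add: floor_eq_iff)
    moreover have "x \<le> (real_of_int \<lfloor>x * 2 ^ n\<rfloor> + 1) / 2 ^ n"
      by (subst pos_le_divide_eq) (simp, linarith)
    ultimately show ?thesis
      unfolding S_def dyadic_digit_partial_sum by (simp add: add_divide_distrib)
  qed
  have hi: "S n \<le> x" for n
  proof -
    have "real_of_int \<lfloor>x * 2 ^ n\<rfloor> / 2 ^ n \<le> x"
      by (simp add: divide_le_eq)
    moreover have "real_of_int \<lfloor>x / 2 ^ n\<rfloor> * 2 ^ n \<ge> 0"
      using assms by simp
    ultimately show ?thesis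
      unfolding S_def dyadic_digit_partial_sum by linarith
  qed
  have le: "sum ?f A \<le> x" if fin: "finite A" for A :: "int set"
  proof -
    obtain m :: nat where m: "\<And>j. j \<in> A \<Longrightarrow> \<bar>j\<bar> < int m"
    proof
      fix j assume "j \<in> A"
      then have "\<bar>j\<bar> \<le> Max (insert 0 (abs ` A))"
        using fin by (intro Max_ge) auto
      then show "\<bar>j\<bar> < int (nat (Max (insert 0 (abs ` A)) + 1))"
        by linarith
    qed
    have "A \<subseteq> {- int m..<int m}"
      using m by force
    then have "sum ?f A \<le> S m"
      unfolding S_def by (intro sum_mono2) auto
    with hi show ?thesis
      by (meson order_trans)
  qed
  have "(?f has_sum (SUP A\<in>{A. finite A \<and> A \<subseteq> UNIV}. sum ?f A)) UNIV"
    by (rule nonneg_bdd_above_has_sum) (auto intro!: bdd_aboveI2[where M = x] le)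
  moreover have "(SUP A\<in>{A. finite A \<and> A \<subseteq> UNIV}. sum ?f A) = x"
  proof (rule cSup_eq_non_empty)
    fix z assume z: "\<And>s. s \<in> sum ?f ` {A. finite A \<and> A \<subseteq> UNIV} \<Longrightarrow> s \<le> z"
    show "x \<le> z"
    proof (rule field_le_epsilon)
      fix e :: real assume "e > 0"
      then obtain a where a: "(1/2) ^ a < e"
        using real_arch_pow_inv[of e "1/2"] by auto
      obtain b where b: "x < 2 ^ b"
        using real_arch_pow[of 2 x] by auto
      have "x < 2 ^ max a b"
        by (rule less_le_trans[OF b power_increasing]) auto
      then have "x - S (max a b) \<le> 1 / 2 ^ max a b"
        by (rule lo)
      moreover have "(1/2::real) ^ max a b \<le> (1/2) ^ a"
        by (intro power_decreasing) auto
      moreover have "S (max a b) \<le> z"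
        unfolding S_def by (rule z) auto
      ultimately show "x \<le> z + e"
        using a by (simp add: power_one_over)
    qed
  qed (auto intro: le)
  ultimately show ?thesis
    by simp
qed

theorem dyadic_digit_zero_infinitely_often:
  "\<exists>j\<ge>N. dyadic_digit x j = 0"
proof (rule ccontr)
  assume "\<not> ?thesis"
  then have one: "dyadic_digit x j = 1" if "j \<ge> N" for j
    using that dyadic_digit_le_1[of x j] by (metis One_nat_def le_Suc_eq le_zero_eq)
  define y where "y = x * 2 powi N"
  define d where "d = 1 + real_of_int \<lfloor>y\<rfloor> - y"
  have "real_of_int \<lfloor>y * 2 ^ k\<rfloor> = (real_of_int \<lfloor>y\<rfloor> + 1) * 2 ^ k - 1" for k
  proof (induction k)
    case (Suc k)
    have eq: "x * 2 powi (N + int k + 1) = y * 2 ^ Suc k" "x * 2 powi (N + int k) = y * 2 ^ k"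
      by (simp_all add: y_def power_int_add)
    have p: "(2::real) powi (- (N + int k)) = 2 * 2 powi (- (N + int k) - 1)"
      using power_int_add_1'[of "2::real" "- (N + int k) - 1"] by simp
    have "1 * 2 powi (- (N + int k) - 1) =
        (real_of_int \<lfloor>y * 2 ^ Suc k\<rfloor> - 2 * real_of_int \<lfloor>y * 2 ^ k\<rfloor>) * 2 powi (- (N + int k) - 1)"
      using dyadic_digit_step[of x "N + int k"] one[of "N + int k"]
      unfolding eq p by (simp add: algebra_simps)
    then have "real_of_int \<lfloor>y * 2 ^ Suc k\<rfloor> - 2 * real_of_int \<lfloor>y * 2 ^ k\<rfloor> = 1"
      by simp
    then show ?case
      using Suc by (simp add: algebra_simps)
  qed simp
  then have "(real_of_int \<lfloor>y\<rfloor> + 1) * 2 ^ k - 1 \<le> y * 2 ^ k" for k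
    by (metis of_int_floor_le)
  then have "d * 2 ^ k \<le> 1" for k
    unfolding d_def by (simp add: algebra_simps)
  moreover have "d > 0"
    unfolding d_def by linarith
  moreover obtain k where "1 / d < 2 ^ k"
    using real_arch_pow[of 2 "1/d"] by auto
  ultimately show False
    by (simp add: field_simps) (smt (verit))
qed

lemma dyadic_sum_summable:
  assumes "x \<ge> 0" "y \<ge> 0"
  shows "(\<lambda>j. \<bar>real (dyadic_digit x j) - real (dyadic_digit y j)\<bar> * 2 powi (- j - 1)) summable_on UNIV"
proof (rule summable_on_comparison_test)
  show "(\<lambda>j. real (dyadic_digit x j) * 2 powi (- j - 1) + real (dyadic_digit y j) * 2 powi (- j - 1))
          summable_on UNIV"
    using dyadic_digit_has_sum[OF assms(1)] dyadic_digit_has_sum[OF assms(2)]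
    by (intro summable_on_add) (auto simp: summable_on_def)
qed (auto simp flip: distrib_right intro!: mult_right_mono)

lemma dyadic_digit_eventually_zero:
  assumes "x \<ge> 0"
  obtains N where "\<And>j. j \<le> N \<Longrightarrow> dyadic_digit x j = 0"
proof -
  obtain n where n: "x < 2 ^ n"
    using real_arch_pow[of 2 x] by auto
  have "dyadic_digit x j = 0" if "j \<le> - int n - 1" for j
  proof -
    have "x * 2 powi (j + 1) \<le> x * 2 powi (- int n)"
      using that assms by (intro mult_left_mono power_int_increasing) auto
    also have "\<dots> < 1"
      using n by (simp add: power_int_minus field_simps)
    finally have "\<lfloor>x * 2 powi (j + 1)\<rfloor> = 0"
      using assms by (simp add: floor_eq_iff)
    then show ?thesis
      by (simp add: dyadic_digit_def)
  qed
  then show ?thesis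
    using that by blast
qed

lemma finite_walsh_support:
  assumes "t \<ge> 0" "x \<ge> 0"
  shows "finite {j. dyadic_digit t j * dyadic_digit x (- j - 1) \<noteq> 0}"
proof -
  obtain M where M: "\<And>j. j \<le> M \<Longrightarrow> dyadic_digit t j = 0"
    using dyadic_digit_eventually_zero[OF assms(1)] by blast
  obtain N where N: "\<And>j. j \<le> N \<Longrightarrow> dyadic_digit x j = 0"
    using dyadic_digit_eventually_zero[OF assms(2)] by blast
  have "{j. dyadic_digit t j * dyadic_digit x (- j - 1) \<noteq> 0} \<subseteq> {M..- N - 1}"
  proof
    fix j assume "j \<in> {j. dyadic_digit t j * dyadic_digit x (- j - 1) \<noteq> 0}"
    then have "\<not> j \<le> M" "\<not> - j - 1 \<le> N"
      using M N by auto
    then show "j \<in> {M..- N - 1}"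
      by auto
  qed
  then show ?thesis
    using finite_subset by blast
qed

end

theory Submission
  imports Defs
begin

text \<open>
  A Donoho--Stark argument.  Since \<open>\<bar>x - y\<bar> \<le> x \<oplus> y\<close>, a small dyadic variance forces all but 4/25 of the
  mass of \<open>f\<close> into an ordinary interval \<open>A\<close> of length \<open>2 r\<close> (Chebyshev), and likewise that of the
  transform into an interval \<open>B\<close> of length \<open>2 q\<close>.  As Walsh functions are bounded by 1, the part of
  \<open>f\<close> on \<open>A\<close> contributes at most \<open>sqrt (\<bar>A\<bar> \<bar>B\<bar>)\<close> times the norm of \<open>f\<close> to the transform on \<open>B\<close>, so
  Plancherel's theorem makes \<open>r q\<close> bounded below.  Plancherel's theorem itself reduces, on dyadic
  step functions, to the orthogonality of Hadamard matrices.
\<close>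

section \<open>Square integrable functions\<close>

text \<open>If a fraction \<open>d^2\<close> of the mass may lie outside each interval, the argument
  yields \<open>sqrt (1 - d^2) - d \<le> 2 * sqrt (r * q)\<close>, while Chebyshev allows
  \<open>r^2\<close> and \<open>q^2\<close> to be just above the two variances divided by
  \<open>d^2\<close>. The product of the variances is then at least
  \<open>(d * (sqrt (1 - d^2) - d))^4 / 16\<close>, which is largest at
  \<open>d = sin (pi / 8)\<close>, about 0.383, with value about 1.15e-4. The choice
  \<open>d = 2/5\<close> is a rational near this optimum; the distance to 8.5e-5 pays for rounding
  all other constants.

  Two obstacles shape the rest. The transform of an \<open>L2\<close> function is picked by
  \<open>SOME\<close> from a closure, so a limit must be shown to exist before
  \<open>walsh_fourier f\<close> has any property; estimates are therefore proved on
  \<open>L1 \<inter> L2\<close> and carried over by continuity of both sides in the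
  \<open>L2\<close> norm. And in \<open>ennreal\<close> the product \<open>0 * \<infinity>\<close>
  is 0, so a vanishing variance has to be excluded separately for the function and for its
  transform.\<close>

definition square_integrable :: "'a measure \<Rightarrow> ('a \<Rightarrow> complex) \<Rightarrow> bool" where
  "square_integrable M f \<longleftrightarrow> f \<in> borel_measurable M \<and> integrable M (\<lambda>x. (cmod (f x))\<^sup>2)"

text \<open>Real valued, so that limits and triangle inequalities need no case for infinity. The
  Bochner integral of a non-integrable function is 0, so the value is meaningful only together with
  \<open>square_integrable\<close>.\<close>

definition L2_norm :: "'a measure \<Rightarrow> ('a \<Rightarrow> complex) \<Rightarrow> real" where
  "L2_norm M f = sqrt (LINT x|M. (cmod (f x))\<^sup>2)"

lemma square_integrableD [dest, measurable_dest]: "square_integrable M f \<Longrightarrow> f \<in> borel_measurable M"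
  by (simp add: square_integrable_def)

lemma square_integrable_norm_sq [dest]:
  "square_integrable M f \<Longrightarrow> integrable M (\<lambda>x. (cmod (f x))\<^sup>2)"
  by (simp add: square_integrable_def)

lemma L2_norm_nonneg [simp]: "L2_norm M f \<ge> 0"
  by (simp add: L2_norm_def)

lemma L2_norm_power2: "(L2_norm M f)\<^sup>2 = (LINT x|M. (cmod (f x))\<^sup>2)"
  by (simp add: L2_norm_def)

lemma square_integrable_iff_nn:
  "square_integrable M f \<longleftrightarrow>
     f \<in> borel_measurable M \<and> (\<integral>\<^sup>+x. ennreal ((cmod (f x))\<^sup>2) \<partial>M) < \<infinity>"
  unfolding square_integrable_def by (auto simp: integrable_iff_bounded)

lemma nn_integral_norm_sq:
  assumes "square_integrable M f"
  shows "(\<integral>\<^sup>+x. ennreal ((cmod (f x))\<^sup>2) \<partial>M) = ennreal ((L2_norm M f)\<^sup>2)"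
  unfolding L2_norm_power2 using assms by (intro nn_integral_eq_integral) auto

lemma square_integrable_mono:
  assumes "square_integrable M g" "f \<in> borel_measurable M" "AE x in M. cmod (f x) \<le> cmod (g x)"
  shows "square_integrable M f" "L2_norm M f \<le> L2_norm M g"
proof -
  have ae: "AE x in M. (cmod (f x))\<^sup>2 \<le> (cmod (g x))\<^sup>2"
    using assms(3) by eventually_elim (simp add: power_mono)
  show *: "square_integrable M f"
    unfolding square_integrable_def
  proof
    show "integrable M (\<lambda>x. (cmod (f x))\<^sup>2)"
      by (rule Bochner_Integration.integrable_bound[OF square_integrable_norm_sq[OF assms(1)]])
        (use assms(2) ae in auto)
  qed fact
  show "L2_norm M f \<le> L2_norm M g"
    unfolding L2_norm_def using * assms(1) ae
    by (intro real_sqrt_le_mono integral_mono_AE) auto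
qed

lemma Cauchy_Schwarz_L2:
  assumes f: "square_integrable M f" and g: "square_integrable M g"
  shows "integrable M (\<lambda>x. cmod (f x) * cmod (g x))"
    and "(LINT x|M. cmod (f x) * cmod (g x)) \<le> L2_norm M f * L2_norm M g"
proof -
  have [measurable]: "f \<in> borel_measurable M" "g \<in> borel_measurable M"
    using f g by auto
  show i: "integrable M (\<lambda>x. cmod (f x) * cmod (g x))"
  proof (rule Bochner_Integration.integrable_bound)
    show "integrable M (\<lambda>x. (cmod (f x))\<^sup>2 + (cmod (g x))\<^sup>2)"
      using f g by auto
    show "AE x in M. norm (cmod (f x) * cmod (g x)) \<le> norm ((cmod (f x))\<^sup>2 + (cmod (g x))\<^sup>2)"
    proof (rule AE_I2)
      fix x
      have "2 * (cmod (f x) * cmod (g x)) \<le> (cmod (f x))\<^sup>2 + (cmod (g x))\<^sup>2"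
        using sum_squares_bound[of "cmod (f x)" "cmod (g x)"] by (simp add: mult.assoc)
      moreover have "cmod (f x) * cmod (g x) \<ge> 0" by simp
      ultimately have "cmod (f x) * cmod (g x) \<le> (cmod (f x))\<^sup>2 + (cmod (g x))\<^sup>2"
        by linarith
      then show "norm (cmod (f x) * cmod (g x)) \<le> norm ((cmod (f x))\<^sup>2 + (cmod (g x))\<^sup>2)"
        by simp
    qed
  qed simp
  let ?I = "LINT x|M. cmod (f x) * cmod (g x)"
  have "(\<integral>\<^sup>+x. ennreal (cmod (f x)) * ennreal (cmod (g x)) \<partial>M)\<^sup>2 \<le>
      (\<integral>\<^sup>+x. (ennreal (cmod (f x)))\<^sup>2 \<partial>M) * (\<integral>\<^sup>+x. (ennreal (cmod (g x)))\<^sup>2 \<partial>M)"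
    by (rule Cauchy_Schwarz_nn_integral) auto
  also have "(\<integral>\<^sup>+x. ennreal (cmod (f x)) * ennreal (cmod (g x)) \<partial>M) = ennreal ?I"
    using nn_integral_eq_integral[OF i] by (simp add: ennreal_mult)
  also have "(\<integral>\<^sup>+x. (ennreal (cmod (f x)))\<^sup>2 \<partial>M) = ennreal ((L2_norm M f)\<^sup>2)"
    using nn_integral_norm_sq[OF f] by (simp add: ennreal_power)
  also have "(\<integral>\<^sup>+x. (ennreal (cmod (g x)))\<^sup>2 \<partial>M) = ennreal ((L2_norm M g)\<^sup>2)"
    using nn_integral_norm_sq[OF g] by (simp add: ennreal_power)
  finally have "ennreal (?I\<^sup>2) \<le> ennreal ((L2_norm M f * L2_norm M g)\<^sup>2)"
    by (simp add: ennreal_power flip: ennreal_mult power_mult_distrib)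
  then have "?I\<^sup>2 \<le> (L2_norm M f * L2_norm M g)\<^sup>2"
    by (subst (asm) ennreal_le_iff) auto
  then show "?I \<le> L2_norm M f * L2_norm M g"
    by (rule power2_le_imp_le) simp
qed

lemma Minkowski_L2:
  assumes f: "square_integrable M f" and g: "square_integrable M g"
  shows "square_integrable M (\<lambda>x. f x + g x)"
    and "L2_norm M (\<lambda>x. f x + g x) \<le> L2_norm M f + L2_norm M g"
proof -
  have [measurable]: "f \<in> borel_measurable M" "g \<in> borel_measurable M"
    using f g by auto
  let ?b = "\<lambda>x. (cmod (f x))\<^sup>2 + 2 * (cmod (f x) * cmod (g x)) + (cmod (g x))\<^sup>2"
  have le: "(cmod (f x + g x))\<^sup>2 \<le> ?b x" for x
  proof -
    have "(cmod (f x + g x))\<^sup>2 \<le> (cmod (f x) + cmod (g x))\<^sup>2"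
      by (intro power_mono norm_triangle_ineq) simp
    then show ?thesis by (simp add: power2_sum mult.assoc)
  qed
  have b: "integrable M ?b"
    using Cauchy_Schwarz_L2(1)[OF f g]
    by (intro Bochner_Integration.integrable_add integrable_mult_right square_integrable_norm_sq f g)
  have i: "integrable M (\<lambda>x. (cmod (f x + g x))\<^sup>2)"
    using le by (intro Bochner_Integration.integrable_bound[OF b]) (auto intro!: AE_I2 order_trans[OF le])
  then show "square_integrable M (\<lambda>x. f x + g x)"
    by (simp add: square_integrable_def)
  have "(L2_norm M (\<lambda>x. f x + g x))\<^sup>2 \<le> (LINT x|M. ?b x)"
    unfolding L2_norm_power2 by (intro integral_mono i b le)
  also have "\<dots> = (L2_norm M f)\<^sup>2 + 2 * (LINT x|M. cmod (f x) * cmod (g x)) + (L2_norm M g)\<^sup>2"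
    unfolding L2_norm_power2 using f g Cauchy_Schwarz_L2(1)[OF f g]
    by (simp add: square_integrable_norm_sq)
  also have "\<dots> \<le> (L2_norm M f + L2_norm M g)\<^sup>2"
    using Cauchy_Schwarz_L2(2)[OF f g] by (simp add: power2_sum)
  finally show "L2_norm M (\<lambda>x. f x + g x) \<le> L2_norm M f + L2_norm M g"
    by (rule power2_le_imp_le) simp
qed

lemma L2_norm_minus_commute: "L2_norm M (\<lambda>x. f x - g x) = L2_norm M (\<lambda>x. g x - f x)"
  by (simp add: L2_norm_def norm_minus_commute)

lemma
  assumes f: "square_integrable M f" and g: "square_integrable M g"
  shows square_integrable_diff: "square_integrable M (\<lambda>x. f x - g x)"
    and L2_norm_diff: "L2_norm M (\<lambda>x. f x - g x) \<le> L2_norm M f + L2_norm M g"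
    and L2_norm_triangle: "L2_norm M f \<le> L2_norm M g + L2_norm M (\<lambda>x. f x - g x)"
proof -
  have "square_integrable M (\<lambda>x. - g x)" "L2_norm M (\<lambda>x. - g x) = L2_norm M g"
    using g by (auto simp: square_integrable_def L2_norm_def)
  with Minkowski_L2[OF f this(1)]
  show d: "square_integrable M (\<lambda>x. f x - g x)" "L2_norm M (\<lambda>x. f x - g x) \<le> L2_norm M f + L2_norm M g"
    by auto
  show "L2_norm M f \<le> L2_norm M g + L2_norm M (\<lambda>x. f x - g x)"
    using Minkowski_L2(2)[OF g d(1)] by simp
qed

lemma L2_norm_diff_triangle:
  assumes "square_integrable M f" "square_integrable M g" "square_integrable M h"
  shows "L2_norm M (\<lambda>x. f x - h x) \<le> L2_norm M (\<lambda>x. f x - g x) + L2_norm M (\<lambda>x. g x - h x)"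
  using Minkowski_L2(2)[OF square_integrable_diff[OF assms(1,2)] square_integrable_diff[OF assms(2,3)]]
  by simp

lemma tendsto_L2_norm:
  assumes "\<And>n. square_integrable M (F n)" "square_integrable M f"
    and lim: "(\<lambda>n. L2_norm M (\<lambda>x. F n x - f x)) \<longlonglongrightarrow> 0"
  shows "(\<lambda>n. L2_norm M (F n)) \<longlonglongrightarrow> L2_norm M f"
proof (rule LIM_zero_cancel, rule Lim_null_comparison[OF _ lim])
  have "\<bar>L2_norm M (F n) - L2_norm M f\<bar> \<le> L2_norm M (\<lambda>x. F n x - f x)" for n
    using L2_norm_triangle[OF assms(1)[of n] assms(2)] L2_norm_triangle[OF assms(2) assms(1)[of n]]
      L2_norm_minus_commute[of M f "F n"] by linarith
  then show "\<forall>\<^sub>F n in sequentially. norm (L2_norm M (F n) - L2_norm M f)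
      \<le> L2_norm M (\<lambda>x. F n x - f x)"
    by simp
qed

section \<open>Pointwise limits and completeness in L2\<close>

lemma Fatou_L2:
  assumes F: "\<And>n. square_integrable M (F n)" and f [measurable]: "f \<in> borel_measurable M"
    and lim: "AE x in M. (\<lambda>n. F n x) \<longlonglongrightarrow> f x"
    and bound: "\<forall>\<^sub>F n in sequentially. L2_norm M (F n) \<le> B"
  shows "square_integrable M f" "L2_norm M f \<le> B"
proof -
  have [measurable]: "\<And>n. F n \<in> borel_measurable M" using F by auto
  have B: "B \<ge> 0"
    using bound L2_norm_nonneg order_trans unfolding eventually_sequentially by blast
  have "(\<integral>\<^sup>+x. ennreal ((cmod (f x))\<^sup>2) \<partial>M) =
      (\<integral>\<^sup>+x. liminf (\<lambda>n. ennreal ((cmod (F n x))\<^sup>2)) \<partial>M)"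
  proof (rule nn_integral_cong_AE, use lim in eventually_elim)
    fix x assume "(\<lambda>n. F n x) \<longlonglongrightarrow> f x"
    then have "(\<lambda>n. ennreal ((cmod (F n x))\<^sup>2)) \<longlonglongrightarrow> ennreal ((cmod (f x))\<^sup>2)"
      by (intro tendsto_intros)
    then show "ennreal ((cmod (f x))\<^sup>2) = liminf (\<lambda>n. ennreal ((cmod (F n x))\<^sup>2))"
      by (intro lim_imp_Liminf[symmetric]) simp_all
  qed
  also have "\<dots> \<le> liminf (\<lambda>n. \<integral>\<^sup>+x. ennreal ((cmod (F n x))\<^sup>2) \<partial>M)"
    by (rule nn_integral_liminf) simp
  also have "\<dots> = liminf (\<lambda>n. ennreal ((L2_norm M (F n))\<^sup>2))"
    by (simp add: nn_integral_norm_sq[OF F])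
  also have "\<dots> \<le> liminf (\<lambda>n. ennreal (B\<^sup>2))"
    by (rule Liminf_mono, use bound in eventually_elim) (intro ennreal_leI power_mono, auto)
  also have "\<dots> = ennreal (B\<^sup>2)"
    by (simp add: Liminf_const)
  finally have le: "(\<integral>\<^sup>+x. ennreal ((cmod (f x))\<^sup>2) \<partial>M) \<le> ennreal (B\<^sup>2)" .
  then show si: "square_integrable M f"
    unfolding square_integrable_iff_nn by (simp add: le_less_trans)
  have "(L2_norm M f)\<^sup>2 \<le> B\<^sup>2"
    using le unfolding nn_integral_norm_sq[OF si] by simp
  then show "L2_norm M f \<le> B"
    using B by (rule power2_le_imp_le)
qed

text \<open>The squared norms of the increments decay like \<open>16 ^ (-n)\<close>, so the weights
  \<open>4 ^ n\<close> still leave a convergent series. Finiteness almost everywhere of the weighted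
  sum forces the increments below a multiple of \<open>(1/2) ^ n\<close>, hence pointwise
  convergence; Fatou's lemma turns the pointwise limit into a norm limit.\<close>

lemma L2_complete_geometric:
  assumes F: "\<And>n. square_integrable M (F n)"
    and step: "\<And>n. L2_norm M (\<lambda>x. F (Suc n) x - F n x) \<le> K * (1/4) ^ n"
  obtains g where "square_integrable M g" "(\<lambda>n. L2_norm M (\<lambda>x. F n x - g x)) \<longlonglongrightarrow> 0"
proof -
  define d where "d n x = F (Suc n) x - F n x" for n x
  have d: "square_integrable M (d n)" for n
    unfolding d_def by (intro square_integrable_diff F)
  have [measurable]: "F n \<in> borel_measurable M" "d n \<in> borel_measurable M" for n using F d by auto
  have "(\<integral>\<^sup>+x. (\<Sum>n. ennreal (4 ^ n * (cmod (d n x))\<^sup>2)) \<partial>M) =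
      (\<Sum>n. \<integral>\<^sup>+x. ennreal (4 ^ n * (cmod (d n x))\<^sup>2) \<partial>M)"
    by (rule nn_integral_suminf) simp
  also have "\<dots> \<le> (\<Sum>n. ennreal (K\<^sup>2 * (1/4) ^ n))"
  proof (rule suminf_le)
    fix n
    have "(\<integral>\<^sup>+x. ennreal (4 ^ n * (cmod (d n x))\<^sup>2) \<partial>M) =
        ennreal (4 ^ n) * (\<integral>\<^sup>+x. ennreal ((cmod (d n x))\<^sup>2) \<partial>M)"
      by (simp add: ennreal_mult' nn_integral_cmult)
    also have "\<dots> = ennreal (4 ^ n * (L2_norm M (d n))\<^sup>2)"
      by (simp add: nn_integral_norm_sq[OF d] ennreal_mult')
    also have "\<dots> \<le> ennreal (4 ^ n * (K * (1/4) ^ n)\<^sup>2)"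
      using step[of n] by (intro ennreal_leI mult_left_mono power_mono) (auto simp: d_def[abs_def])
    also have "4 ^ n * (K * (1/4) ^ n)\<^sup>2 = K\<^sup>2 * (1/4) ^ n * (4 * (1/4)) ^ n"
      by (simp only: power_mult_distrib power2_eq_square mult_ac)
    also have "\<dots> = K\<^sup>2 * (1/4) ^ n"
      by simp
    finally show "(\<integral>\<^sup>+x. ennreal (4 ^ n * (cmod (d n x))\<^sup>2) \<partial>M) \<le> ennreal (K\<^sup>2 * (1/4) ^ n)" .
  qed auto
  also have "\<dots> < \<infinity>"
    by (subst suminf_ennreal2) (auto intro!: summable_mult summable_geometric)
  finally have "AE x in M. (\<Sum>n. ennreal (4 ^ n * (cmod (d n x))\<^sup>2)) \<noteq> \<infinity>"
    by (intro nn_integral_PInf_AE) auto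
  then have ae: "AE x in M. convergent (\<lambda>n. F n x)"
  proof eventually_elim
    fix x assume "(\<Sum>n. ennreal (4 ^ n * (cmod (d n x))\<^sup>2)) \<noteq> \<infinity>"
    then have sm: "summable (\<lambda>n. 4 ^ n * (cmod (d n x))\<^sup>2)"
      by (intro summable_suminf_not_top) (auto simp: top_ennreal_def)
    obtain C where C: "\<And>n. 4 ^ n * (cmod (d n x))\<^sup>2 \<le> C" "C \<ge> 0"
    proof
      fix n show "4 ^ n * (cmod (d n x))\<^sup>2 \<le> (\<Sum>n. 4 ^ n * (cmod (d n x))\<^sup>2)"
        using sum_le_suminf[OF sm, of "{n}"] by simp
      show "(\<Sum>n. 4 ^ n * (cmod (d n x))\<^sup>2) \<ge> 0"
        by (intro suminf_nonneg sm) simp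
    qed
    have "cmod (d n x) \<le> sqrt C * (1/2) ^ n" for n
    proof (rule power2_le_imp_le)
      have "(sqrt C * (1/2) ^ n)\<^sup>2 = C / 4 ^ n"
        using C(2) power_even_eq[of "2::real" n]
        by (simp add: power_mult_distrib power_divide power_mult)
      moreover have "(cmod (d n x))\<^sup>2 \<le> C / 4 ^ n"
        using C(1)[of n] by (simp add: pos_le_divide_eq mult.commute)
      ultimately show "(cmod (d n x))\<^sup>2 \<le> (sqrt C * (1/2) ^ n)\<^sup>2"
        by simp
    qed (use C in auto)
    then have "summable (\<lambda>n. d n x)"
      by (intro summable_comparison_test'[where N = 0, OF summable_mult[OF summable_geometric]]) auto
    then have "convergent (\<lambda>n. \<Sum>i<n. d i x)"
      by (simp add: summable_iff_convergent)
    then have "convergent (\<lambda>n. F 0 x + (\<Sum>i<n. d i x))"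
      by (intro convergent_add convergent_const)
    moreover have "F 0 x + (\<Sum>i<n. d i x) = F n x" for n
      unfolding d_def by (subst sum_lessThan_telescope) simp
    ultimately show "convergent (\<lambda>n. F n x)"
      by simp
  qed
  define g where "g x = lim (\<lambda>n. F n x)" for x
  have [measurable]: "g \<in> borel_measurable M"
    unfolding g_def by measurable
  have lim: "AE x in M. (\<lambda>n. F n x) \<longlonglongrightarrow> g x"
    using ae by eventually_elim (simp add: g_def convergent_LIMSEQ_iff)
  have K: "K \<ge> 0"
    using step[of 0] by (simp add: order_trans[OF L2_norm_nonneg])
  \<comment> \<open>The subtracted tail lets the induction close: the new term
    \<open>K * (1/4) ^ (n + k)\<close> uses up half of \<open>2 * K * (1/4) ^ (n + k)\<close>, and
    the other half is at least the next tail \<open>2 * K * (1/4) ^ (n + Suc k)\<close>.\<close>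
  have bound: "L2_norm M (\<lambda>x. F (n + k) x - F n x) \<le> 2 * K * (1/4) ^ n - 2 * K * (1/4) ^ (n + k)" for n k
  proof (induction k)
    case (Suc k)
    have "L2_norm M (\<lambda>x. F (n + Suc k) x - F n x) \<le>
        L2_norm M (\<lambda>x. F (Suc (n + k)) x - F (n + k) x) + L2_norm M (\<lambda>x. F (n + k) x - F n x)"
      using L2_norm_diff_triangle[OF F[of "n + Suc k"] F[of "n + k"] F[of n]] by simp
    also have "\<dots> \<le> K * (1/4) ^ (n + k) + (2 * K * (1/4) ^ n - 2 * K * (1/4) ^ (n + k))"
      by (intro add_mono step Suc.IH)
    also have "\<dots> \<le> 2 * K * (1/4) ^ n - 2 * K * (1/4) ^ (n + Suc k)"
      using K by (simp add: mult_nonneg_nonneg)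
    finally show ?case .
  qed (simp add: L2_norm_def)
  have bound': "L2_norm M (\<lambda>x. F k x - F n x) \<le> 2 * K * (1/4) ^ n" if "n \<le> k" for n k
  proof -
    have "0 \<le> 2 * K * (1/4) ^ k" using K by simp
    then show ?thesis using bound[of n "k - n"] that by simp
  qed
  \<comment> \<open>Fatou in \<open>k\<close> with \<open>n\<close> fixed: the bound on the distance
    from \<open>F n\<close> to all later members passes to their pointwise limit.\<close>
  have diff: "square_integrable M (\<lambda>x. g x - F n x)" "L2_norm M (\<lambda>x. g x - F n x) \<le> 2 * K * (1/4) ^ n" for n
  proof -
    have 1: "square_integrable M (\<lambda>x. F k x - F n x)" for k
      by (intro square_integrable_diff F)
    have 2: "AE x in M. (\<lambda>k. F k x - F n x) \<longlonglongrightarrow> g x - F n x"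
      using lim by eventually_elim (intro tendsto_intros)
    have 3: "\<forall>\<^sub>F k in sequentially. L2_norm M (\<lambda>x. F k x - F n x) \<le> 2 * K * (1/4) ^ n"
      using bound' by (auto simp: eventually_sequentially)
    show "square_integrable M (\<lambda>x. g x - F n x)" "L2_norm M (\<lambda>x. g x - F n x) \<le> 2 * K * (1/4) ^ n"
      by (rule Fatou_L2[OF 1 _ 2 3]; simp)+
  qed
  show ?thesis
  proof
    show "square_integrable M g"
      using Minkowski_L2(1)[OF diff(1)[of 0] F[of 0]] by simp
    have "(\<lambda>n. 2 * K * (1/4) ^ n) \<longlonglongrightarrow> 0"
      by (intro tendsto_mult_right_zero LIMSEQ_power_zero) simp
    then show "(\<lambda>n. L2_norm M (\<lambda>x. F n x - g x)) \<longlonglongrightarrow> 0"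
      by (rule Lim_null_comparison[rotated])
        (use diff(2) in \<open>simp add: L2_norm_minus_commute[of M _ g]\<close>)
  qed
qed

section \<open>Walsh functions as Hadamard matrices\<close>

text \<open>The Sylvester-Hadamard matrix of order \<open>2 ^ n\<close> with bit-reversed row index.
  The reversal mirrors the Walsh function, which pairs digit \<open>j\<close> of one argument with
  digit \<open>- j - 1\<close> of the other.\<close>

definition hadamard :: "nat \<Rightarrow> nat \<Rightarrow> nat \<Rightarrow> real" where
  "hadamard n l k = (\<Prod>i<n. if bit l (n - 1 - i) \<and> bit k i then - 1 else 1)"

lemma hadamard_square: "hadamard n l k * hadamard n l k = 1"
  unfolding hadamard_def by (simp add: prod.neutral flip: prod.distrib)

text \<open>Bit \<open>n - 1 - i\<close> of the row index enters only the factor at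
  \<open>i\<close>, and there it matters exactly when column \<open>k\<close> has bit
  \<open>i\<close> set.\<close>

lemma hadamard_flip_bit:
  assumes "i < n"
  shows "hadamard n (flip_bit (n - 1 - i) l) k = (if bit k i then - 1 else 1) * hadamard n l k"
proof -
  let ?h = "\<lambda>l i. if bit l (n - 1 - i) \<and> bit k i then - 1 else 1 :: real"
  let ?l = "flip_bit (n - 1 - i) l"
  have "?h ?l j = ?h l j" if "j \<in> {..<n} - {i}" for j
  proof -
    have "n - 1 - j \<noteq> n - 1 - i" using that assms by auto
    then show ?thesis by (simp add: bit_flip_bit_iff)
  qed
  then have "(\<Prod>j\<in>{..<n} - {i}. ?h ?l j) = (\<Prod>j\<in>{..<n} - {i}. ?h l j)"
    by (intro prod.cong refl)
  moreover have "?h ?l i = (if bit k i then - 1 else 1) * ?h l i"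
    by (auto simp: bit_flip_bit_iff)
  ultimately show ?thesis
    unfolding hadamard_def using assms
    by (simp only: prod.remove[of "{..<n}" i] finite_lessThan lessThan_iff mult.assoc)
qed

lemma flip_bit_less_exp:
  fixes l :: nat
  assumes "l < 2 ^ n" "p < n"
  shows "flip_bit p l < 2 ^ n"
proof -
  have "take_bit n (flip_bit p l) = flip_bit p l"
  proof (rule bit_eqI)
    fix i
    have "\<not> bit l i" if "n \<le> i"
      using assms(1) that bit_take_bit_iff[of n l i] by (simp add: take_bit_nat_eq_self)
    then show "bit (take_bit n (flip_bit p l)) i = bit (flip_bit p l) i"
      using assms(2) by (cases "i < n") (auto simp: bit_take_bit_iff bit_flip_bit_iff)
  qed
  then show ?thesis
    by (simp add: take_bit_nat_eq_self_iff)
qed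

text \<open>Distinct columns differ in some bit \<open>i\<close>. Flipping bit
  \<open>n - 1 - i\<close> of the row index is an involution of the rows that negates every summand,
  so the sum equals its own negative.\<close>

lemma hadamard_orthogonal:
  assumes "k < 2 ^ n" "k' < 2 ^ n"
  shows "(\<Sum>l<2 ^ n. hadamard n l k * hadamard n l k') = (if k = k' then 2 ^ n else 0)"
proof (cases "k = k'")
  case False
  obtain i where i: "bit k i \<noteq> bit k' i"
    using False by (auto simp: bit_eq_iff)
  have "i < n"
  proof (rule ccontr)
    assume "\<not> i < n"
    then have "\<not> bit k i" "\<not> bit k' i"
      using assms bit_take_bit_iff[of n k i] bit_take_bit_iff[of n k' i]
      by (simp_all add: take_bit_nat_eq_self)
    with i show False by simp
  qed
  define p where "p = n - 1 - i"
  have p: "p < n" using \<open>i < n\<close> by (simp add: p_def)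
  let ?g = "\<lambda>l. hadamard n l k * hadamard n l k'"
  have flip: "flip_bit p (flip_bit p l) = l" for l :: nat
    by (rule bit_eqI) (auto simp: bit_flip_bit_iff)
  have "(\<Sum>l<2 ^ n. ?g l) = (\<Sum>l<2 ^ n. ?g (flip_bit p l))"
    by (rule sum.reindex_bij_witness[of _ "flip_bit p" "flip_bit p"])
      (use flip_bit_less_exp[OF _ p] flip in auto)
  also have "\<dots> = (\<Sum>l<2 ^ n. - ?g l)"
    using i unfolding p_def by (intro sum.cong refl) (unfold hadamard_flip_bit[OF \<open>i < n\<close>], auto)
  finally show ?thesis
    using False by (simp add: sum_negf)
qed (simp add: hadamard_square)

section \<open>Dyadic digits as bits, and Walsh functions as matrix entries\<close>

lemma dyadic_digit_eq_bit:
  assumes "y \<ge> 0"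
  shows "dyadic_digit y (int n - 1 - int i) = of_bool (bit (nat \<lfloor>y * 2 ^ n\<rfloor>) i)"
proof -
  have "y * 2 powi (int n - 1 - int i + 1) = y * 2 ^ n / real_of_int (2 ^ i)"
    using power_int_diff[of "2::real" "int n" "int i"] by simp
  then have "\<lfloor>y * 2 powi (int n - 1 - int i + 1)\<rfloor> = \<lfloor>y * 2 ^ n\<rfloor> div 2 ^ i"
    using floor_divide_real_eq_div[of "2 ^ i" "y * 2 ^ n"] by simp
  moreover have "\<lfloor>y * 2 ^ n\<rfloor> div 2 ^ i = int (nat \<lfloor>y * 2 ^ n\<rfloor> div 2 ^ i)"
    using assms by (simp add: zdiv_int)
  ultimately show ?thesis
    unfolding dyadic_digit_def bit_iff_odd
    by (simp only: mod_2_eq_odd nat_of_bool even_of_nat)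
qed

lemma nat_floor_less:
  assumes "0 \<le> y" "y < 2 ^ n"
  shows "nat \<lfloor>y * 2 ^ n\<rfloor> < 2 ^ (2 * n)"
proof -
  have "y * 2 ^ n < 2 ^ n * 2 ^ n"
    using assms by simp
  then have "\<lfloor>y * 2 ^ n\<rfloor> < 2 ^ (2 * n)"
    by (simp add: floor_less_iff mult_2 power_add)
  then show ?thesis
    by (simp add: nat_less_iff assms)
qed

text \<open>Below \<open>2 ^ n\<close> every digit with index less than \<open>- n\<close> vanishes.
  Since digit \<open>j\<close> of \<open>t\<close> meets digit \<open>- j - 1\<close> of
  \<open>x\<close>, only \<open>- n \<le> j < n\<close> survives, and these digits are the
  \<open>2 * n\<close> low bits of the two floors. The finer digits of either argument meet zeros of
  the other, so \<open>walsh\<close> is constant on cells of length \<open>2 ^ (-n)\<close> in both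
  variables.\<close>

lemma walsh_eq_hadamard:
  assumes t: "0 \<le> t" "t < 2 ^ n" and x: "0 \<le> x" "x < 2 ^ n"
  shows "walsh t x = hadamard (2 * n) (nat \<lfloor>t * 2 ^ n\<rfloor>) (nat \<lfloor>x * 2 ^ n\<rfloor>)"
proof -
  define e where "e j = dyadic_digit t j * dyadic_digit x (- j - 1)" for j
  have small: "\<not> bit (nat \<lfloor>y * 2 ^ n\<rfloor>) i" if "0 \<le> y" "y < 2 ^ n" "2 * n \<le> i" for y i
    using nat_floor_less[OF that(1,2)] that(3) bit_take_bit_iff[of "2 * n" "nat \<lfloor>y * 2 ^ n\<rfloor>" i]
    by (simp add: take_bit_nat_eq_self)
  have sub: "{j. e j \<noteq> 0} \<subseteq> {- int n..<int n}"
  proof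
    fix j assume j: "j \<in> {j. e j \<noteq> 0}"
    have "\<not> j < - int n"
    proof
      assume "j < - int n"
      then obtain i where i: "j = int n - 1 - int i" "2 * n \<le> i"
        by (intro that[of "nat (int n - 1 - j)"]) auto
      show False
        using j small[OF t i(2)] by (simp add: e_def i(1) dyadic_digit_eq_bit[OF t(1)])
    qed
    moreover have "\<not> int n \<le> j"
    proof
      assume "int n \<le> j"
      then obtain i where i: "- j - 1 = int n - 1 - int i" "2 * n \<le> i"
        by (intro that[of "nat (int n + j)"]) auto
      show False
        using j small[OF x i(2)] by (simp add: e_def i(1) dyadic_digit_eq_bit[OF x(1)])
    qed
    ultimately show "j \<in> {- int n..<int n}" by simp
  qed
  have "walsh t x = (- 1) ^ (\<Sum>j\<in>{- int n..<int n}. e j)"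
    unfolding walsh_def e_def[symmetric]
    by (intro arg_cong[where f = "\<lambda>m. (- 1) ^ m"] sum.mono_neutral_left) (use sub in auto)
  also have "(\<Sum>j\<in>{- int n..<int n}. e j) = (\<Sum>i<2 * n. e (int i - int n))"
    by (rule sum.reindex_bij_witness[of _ "\<lambda>i. int i - int n" "\<lambda>j. nat (j + int n)"]) auto
  also have "(- 1) ^ \<dots> = (\<Prod>i<2 * n. (- 1 :: real) ^ e (int i - int n))"
    by (simp add: power_sum)
  also have "\<dots> = hadamard (2 * n) (nat \<lfloor>t * 2 ^ n\<rfloor>) (nat \<lfloor>x * 2 ^ n\<rfloor>)"
    unfolding hadamard_def
  proof (intro prod.cong refl)
    fix i assume i: "i \<in> {..<2 * n}"
    \<comment> \<open>With \<open>j = i - n\<close>, the digit of \<open>t\<close> is bit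
      \<open>2 * n - 1 - i\<close> and that of \<open>x\<close> is bit \<open>i\<close>: this is the
      bit reversal built into \<open>hadamard\<close>.\<close>
    have 1: "int i - int n = int n - 1 - int (2 * n - 1 - i)" and 2: "- (int i - int n) - 1 = int n - 1 - int i"
      using i by (auto simp: of_nat_diff)
    have "e (int i - int n) = of_bool (bit (nat \<lfloor>t * 2 ^ n\<rfloor>) (2 * n - 1 - i) \<and> bit (nat \<lfloor>x * 2 ^ n\<rfloor>) i)"
      unfolding e_def 2 dyadic_digit_eq_bit[OF x(1)] unfolding 1 dyadic_digit_eq_bit[OF t(1)]
      by simp
    then show "(- 1 :: real) ^ e (int i - int n) =
        (if bit (nat \<lfloor>t * 2 ^ n\<rfloor>) (2 * n - 1 - i) \<and> bit (nat \<lfloor>x * 2 ^ n\<rfloor>) i then - 1 else 1)"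
      by simp
  qed
  finally show ?thesis .
qed

lemma abs_walsh [simp]: "\<bar>walsh t x\<bar> = 1"
  by (simp add: walsh_def power_abs)

section \<open>The transform of dyadic step functions\<close>

text \<open>One parameter governs both the support and the resolution. Time and frequency then use
  the same grid of \<open>2 ^ (2 * n)\<close> cells, and the transform restricted to
  \<open>[0, 2 ^ n)\<close> is again a step function of level \<open>n\<close>.\<close>

definition dyadic_step :: "nat \<Rightarrow> (real \<Rightarrow> 'a::zero) \<Rightarrow> bool" where
  "dyadic_step n s \<longleftrightarrow> (\<forall>x. s x \<noteq> 0 \<longrightarrow> 0 \<le> x \<and> x < 2 ^ n) \<and>
     (\<forall>x y. 0 \<le> x \<longrightarrow> 0 \<le> y \<longrightarrow> \<lfloor>x * 2 ^ n\<rfloor> = \<lfloor>y * 2 ^ n\<rfloor> \<longrightarrow> s x = s y)"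

lemma dyadic_step_zero: "dyadic_step n s \<Longrightarrow> \<not> (0 \<le> x \<and> x < 2 ^ n) \<Longrightarrow> s x = 0"
  unfolding dyadic_step_def by blast

lemma dyadic_step_cong_floor:
  "dyadic_step n s \<Longrightarrow> 0 \<le> x \<Longrightarrow> 0 \<le> y \<Longrightarrow> \<lfloor>x * 2 ^ n\<rfloor> = \<lfloor>y * 2 ^ n\<rfloor> \<Longrightarrow> s x = s y"
  unfolding dyadic_step_def by blast

lemma dyadic_step_mono:
  assumes s: "dyadic_step n s" and "n \<le> m"
  shows "dyadic_step m s"
proof -
  obtain k where m: "m = n + k" using \<open>n \<le> m\<close> le_Suc_ex by blast
  have fl: "\<lfloor>x * 2 ^ n\<rfloor> = \<lfloor>x * 2 ^ m\<rfloor> div 2 ^ k" for x :: real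
    using floor_divide_real_eq_div[of "2 ^ k" "x * 2 ^ m"] by (simp add: m power_add)
  have "(2::real) ^ n \<le> 2 ^ m" using \<open>n \<le> m\<close> by simp
  then show ?thesis
    using s unfolding dyadic_step_def fl by (metis order_less_le_trans)
qed

text \<open>\<open>2 ^ n\<close> is an integer multiple of the cell length \<open>2 ^ (-m)\<close>,
  so no cell straddles it.\<close>

lemma less_exp_cong_floor:
  fixes x y :: real
  assumes "\<lfloor>x * 2 ^ m\<rfloor> = \<lfloor>y * 2 ^ m\<rfloor>"
  shows "x < 2 ^ n \<longleftrightarrow> y < 2 ^ n"
proof -
  have "z < 2 ^ n \<longleftrightarrow> \<lfloor>z * 2 ^ m\<rfloor> < 2 ^ n * 2 ^ m" for z :: real
    by (simp add: floor_less_iff)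
  then show ?thesis
    using assms by simp
qed

lemma floor_nonneg_eq_nat_iff:
  fixes x :: real
  assumes "x \<ge> 0"
  shows "nat \<lfloor>x * 2 ^ n\<rfloor> = k \<longleftrightarrow> real k / 2 ^ n \<le> x \<and> x < (real k + 1) / 2 ^ n"
proof -
  have "nat \<lfloor>x * 2 ^ n\<rfloor> = k \<longleftrightarrow> \<lfloor>x * 2 ^ n\<rfloor> = int k"
    using assms by (auto simp: nat_eq_iff)
  then show ?thesis
    by (simp add: floor_eq_iff pos_divide_le_eq pos_less_divide_eq)
qed

lemma dyadic_step_integral:
  fixes s :: "real \<Rightarrow> 'a::{banach, second_countable_topology}"
  assumes s: "dyadic_step n s"
  shows "has_bochner_integral Rplus s (\<Sum>k<2 ^ (2 * n). s (real k / 2 ^ n) /\<^sub>R 2 ^ n)"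
proof -
  define I where "I k = {real k / 2 ^ n..<(real k + 1) / 2 ^ n}" for k :: nat
  have I: "I k \<in> sets Rplus" "emeasure Rplus (I k) = ennreal (1 / 2 ^ n)" "I k \<subseteq> {0..}" for k
  proof -
    have 0: "0 \<le> real k / 2 ^ n" by simp
    show *: "I k \<subseteq> {0..}"
      unfolding I_def using 0 by (meson atLeastLessThan_iff atLeast_iff order_trans subsetI)
    show "I k \<in> sets Rplus"
      using * unfolding sets_restrict_space by (auto simp: I_def intro!: image_eqI[where x = "I k"])
    have "emeasure Rplus (I k) = emeasure lebesgue (I k)"
      using * by (subst emeasure_restrict_space) auto
    also have "\<dots> = emeasure lborel (I k)"
      by (simp add: I_def)
    also have "\<dots> = ennreal (1 / 2 ^ n)"
      by (simp add: I_def divide_right_mono add_divide_distrib)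
    finally show "emeasure Rplus (I k) = ennreal (1 / 2 ^ n)" .
  qed
  have hb: "has_bochner_integral Rplus (\<lambda>x. \<Sum>k<2 ^ (2 * n). indicator (I k) x *\<^sub>R s (real k / 2 ^ n))
      (\<Sum>k<2 ^ (2 * n). measure Rplus (I k) *\<^sub>R s (real k / 2 ^ n))"
    by (intro has_bochner_integral_sum has_bochner_integral_scaleR_left has_bochner_integral_real_indicator)
      (simp_all add: I)
  have "measure Rplus (I k) = inverse (2 ^ n)" for k
    using I(2)[of k] by (simp add: measure_def inverse_eq_divide)
  then have meas: "(\<Sum>k<2 ^ (2 * n). measure Rplus (I k) *\<^sub>R s (real k / 2 ^ n)) =
      (\<Sum>k<2 ^ (2 * n). s (real k / 2 ^ n) /\<^sub>R 2 ^ n)"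
    by simp
  have "(\<Sum>k<2 ^ (2 * n). indicator (I k) x *\<^sub>R s (real k / 2 ^ n)) = s x" if "x \<in> space Rplus" for x
  proof -
    have x: "x \<ge> 0" using that by (simp add: space_restrict_space)
    have ind: "x \<in> I k \<longleftrightarrow> nat \<lfloor>x * 2 ^ n\<rfloor> = k" for k
      unfolding floor_nonneg_eq_nat_iff[OF x] by (simp add: I_def)
    let ?k = "nat \<lfloor>x * 2 ^ n\<rfloor>"
    have sx: "s (real ?k / 2 ^ n) = s x"
      by (rule dyadic_step_cong_floor[OF s]) (use x in auto)
    have "(\<Sum>k<2 ^ (2 * n). indicator (I k) x *\<^sub>R s (real k / 2 ^ n)) =
        (\<Sum>k<2 ^ (2 * n). if k = ?k then s x else 0)"
      by (intro sum.cong refl) (auto simp: indicator_def ind sx)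
    also have "\<dots> = s x"
    proof (cases "x < 2 ^ n")
      case True
      then show ?thesis using nat_floor_less[OF x True] by simp
    next
      case False
      then show ?thesis using dyadic_step_zero[OF s, of x] by simp
    qed
    finally show ?thesis .
  qed
  then have "has_bochner_integral Rplus s (\<Sum>k<2 ^ (2 * n). s (real k / 2 ^ n) /\<^sub>R 2 ^ n) =
      has_bochner_integral Rplus (\<lambda>x. \<Sum>k<2 ^ (2 * n). indicator (I k) x *\<^sub>R s (real k / 2 ^ n))
      (\<Sum>k<2 ^ (2 * n). measure Rplus (I k) *\<^sub>R s (real k / 2 ^ n))"
    by (intro has_bochner_integral_cong refl meas[symmetric]) (rule sym)
  with hb show ?thesis by iprover
qed

text \<open>After expanding the squared modulus, the row sum is moved innermost, where column
  orthogonality leaves only the diagonal terms.\<close>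

lemma hadamard_Parseval:
  fixes a :: "nat \<Rightarrow> complex"
  shows "(\<Sum>l<2 ^ n. (cmod (\<Sum>k<2 ^ n. a k * complex_of_real (hadamard n l k)))\<^sup>2) =
           2 ^ n * (\<Sum>k<2 ^ n. (cmod (a k))\<^sup>2)"
proof -
  let ?h = "\<lambda>l k. complex_of_real (hadamard n l k)"
  have "complex_of_real (\<Sum>l<2 ^ n. (cmod (\<Sum>k<2 ^ n. a k * ?h l k))\<^sup>2) =
      (\<Sum>l<2 ^ n. \<Sum>k<2 ^ n. \<Sum>k'<2 ^ n. a k * cnj (a k') * complex_of_real (hadamard n l k * hadamard n l k'))"
    unfolding of_real_sum complex_norm_square
    by (simp add: sum_product mult_ac)
  also have "\<dots> = (\<Sum>k<2 ^ n. \<Sum>k'<2 ^ n. \<Sum>l<2 ^ n. a k * cnj (a k') * complex_of_real (hadamard n l k * hadamard n l k'))"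
    by (subst sum.swap, rule sum.cong[OF refl], rule sum.swap)
  also have "\<dots> = (\<Sum>k<2 ^ n. \<Sum>k'<2 ^ n. a k * cnj (a k') * (if k = k' then 2 ^ n else 0))"
  proof (intro sum.cong refl)
    fix k k' :: nat assume k: "k \<in> {..<2 ^ n}" "k' \<in> {..<2 ^ n}"
    have "(\<Sum>l<2 ^ n. a k * cnj (a k') * complex_of_real (hadamard n l k * hadamard n l k')) =
        a k * cnj (a k') * complex_of_real (\<Sum>l<2 ^ n. hadamard n l k * hadamard n l k')"
      by (simp add: sum_distrib_left)
    also have "(\<Sum>l<2 ^ n. hadamard n l k * hadamard n l k') = (if k = k' then 2 ^ n else 0)"
      using k by (intro hadamard_orthogonal) auto
    finally show "(\<Sum>l<2 ^ n. a k * cnj (a k') * complex_of_real (hadamard n l k * hadamard n l k')) =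
        a k * cnj (a k') * (if k = k' then 2 ^ n else 0)"
      by simp
  qed
  also have "\<dots> = (\<Sum>k<2 ^ n. 2 ^ n * complex_of_real ((cmod (a k))\<^sup>2))"
  proof (intro sum.cong refl)
    fix k :: nat assume k: "k \<in> {..<2 ^ n}"
    have "(\<Sum>k'<2 ^ n. a k * cnj (a k') * (if k = k' then 2 ^ n else 0)) = a k * cnj (a k) * 2 ^ n"
      using k by (simp add: if_distrib cong: if_cong)
    then show "(\<Sum>k'<2 ^ n. a k * cnj (a k') * (if k = k' then 2 ^ n else 0)) =
        2 ^ n * complex_of_real ((cmod (a k))\<^sup>2)"
      by (simp only: complex_norm_square mult.commute)
  qed
  also have "\<dots> = complex_of_real (2 ^ n * (\<Sum>k<2 ^ n. (cmod (a k))\<^sup>2))"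
    by (simp add: sum_distrib_left)
  finally show ?thesis
    by (simp only: of_real_eq_iff)
qed

lemma dyadic_step_square_integrable:
  fixes s :: "real \<Rightarrow> complex"
  assumes s: "dyadic_step n s"
  shows "square_integrable Rplus s"
    and "(L2_norm Rplus s)\<^sup>2 = (\<Sum>k<2 ^ (2 * n). (cmod (s (real k / 2 ^ n)))\<^sup>2) / 2 ^ n"
proof -
  have s2: "dyadic_step n (\<lambda>x. (cmod (s x))\<^sup>2)"
    unfolding dyadic_step_def
  proof (intro conjI allI impI)
    fix x y :: real
    assume "0 \<le> x" "0 \<le> y" "\<lfloor>x * 2 ^ n\<rfloor> = \<lfloor>y * 2 ^ n\<rfloor>"
    then show "(cmod (s x))\<^sup>2 = (cmod (s y))\<^sup>2"
      using dyadic_step_cong_floor[OF s, of x y] by simp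
  qed (use dyadic_step_zero[OF s] in force)+
  show "square_integrable Rplus s"
    unfolding square_integrable_def
    using dyadic_step_integral[OF s] dyadic_step_integral[OF s2]
    by (auto simp: has_bochner_integral_iff dest: borel_measurable_integrable)
  show "(L2_norm Rplus s)\<^sup>2 = (\<Sum>k<2 ^ (2 * n). (cmod (s (real k / 2 ^ n)))\<^sup>2) / 2 ^ n"
    using dyadic_step_integral[OF s2] unfolding L2_norm_power2 has_bochner_integral_iff
    by (simp only: sum_distrib_left divide_inverse_commute[of "sum _ _"] real_scaleR_def)
qed

text \<open>The integrand is again a step function of level \<open>n\<close>: where \<open>s\<close>
  is nonzero the argument lies below \<open>2 ^ n\<close>, so the Walsh factor is a matrix entry
  depending only on the cell.\<close>

lemma walsh_fourier_dyadic_step: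
  assumes s: "dyadic_step n s" and t: "0 \<le> t" "t < 2 ^ n"
  shows "walsh_fourier_L1 s t = (\<Sum>k<2 ^ (2 * n). s (real k / 2 ^ n) *
           complex_of_real (hadamard (2 * n) (nat \<lfloor>t * 2 ^ n\<rfloor>) k)) / 2 ^ n"
proof -
  have st: "dyadic_step n (\<lambda>x. s x * complex_of_real (walsh t x))"
    unfolding dyadic_step_def
  proof (intro conjI allI impI)
    fix x y :: real
    assume xy: "0 \<le> x" "0 \<le> y" "\<lfloor>x * 2 ^ n\<rfloor> = \<lfloor>y * 2 ^ n\<rfloor>"
    have "s x = s y" by (rule dyadic_step_cong_floor[OF s xy])
    moreover have "walsh t x = walsh t y" if "s x \<noteq> 0" "s y \<noteq> 0"
    proof -
      have "x < 2 ^ n" "y < 2 ^ n" using dyadic_step_zero[OF s] that by blast+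
      then show ?thesis using xy by (simp add: walsh_eq_hadamard[OF t])
    qed
    ultimately show "s x * complex_of_real (walsh t x) = s y * complex_of_real (walsh t y)"
      by (cases "s y = 0") auto
  qed (use dyadic_step_zero[OF s] in force)+
  have "walsh_fourier_L1 s t =
      (\<Sum>k<2 ^ (2 * n). (s (real k / 2 ^ n) * complex_of_real (walsh t (real k / 2 ^ n))) /\<^sub>R 2 ^ n)"
    unfolding walsh_fourier_L1_def using dyadic_step_integral[OF st] by (simp add: has_bochner_integral_iff)
  also have "\<dots> = (\<Sum>k<2 ^ (2 * n). s (real k / 2 ^ n) *
           complex_of_real (hadamard (2 * n) (nat \<lfloor>t * 2 ^ n\<rfloor>) k) / 2 ^ n)"
  proof (intro sum.cong refl)
    fix k :: nat assume "k \<in> {..<2 ^ (2 * n)}"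
    then have "real k < real (2 ^ (2 * n))"
      by (simp only: lessThan_iff of_nat_less_iff)
    then have "real k / 2 ^ n < 2 ^ n"
      by (simp add: pos_divide_less_eq mult_2 power_add)
    then have "walsh t (real k / 2 ^ n) = hadamard (2 * n) (nat \<lfloor>t * 2 ^ n\<rfloor>) k"
      by (simp add: walsh_eq_hadamard[OF t])
    then show "(s (real k / 2 ^ n) * complex_of_real (walsh t (real k / 2 ^ n))) /\<^sub>R 2 ^ n =
        s (real k / 2 ^ n) * complex_of_real (hadamard (2 * n) (nat \<lfloor>t * 2 ^ n\<rfloor>) k) / 2 ^ n"
      by (simp add: scaleR_conv_of_real divide_inverse)
  qed
  finally show ?thesis
    by (simp add: sum_divide_distrib)
qed

text \<open>The normalisations cancel: the factor \<open>2 ^ (-n)\<close> of the transform enters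
  squared, against the factor \<open>2 ^ (2 * n)\<close> of Parseval's identity.\<close>

lemma walsh_fourier_dyadic_step_trunc:
  assumes s: "dyadic_step n s"
  defines "v \<equiv> \<lambda>t. if 0 \<le> t \<and> t < 2 ^ n then walsh_fourier_L1 s t else 0"
  shows "square_integrable Rplus v" "L2_norm Rplus v = L2_norm Rplus s"
proof -
  have v: "dyadic_step n v"
    unfolding dyadic_step_def
  proof (intro conjI allI impI)
    fix x y :: real
    assume xy: "0 \<le> x" "0 \<le> y" "\<lfloor>x * 2 ^ n\<rfloor> = \<lfloor>y * 2 ^ n\<rfloor>"
    have "x < 2 ^ n \<longleftrightarrow> y < 2 ^ n"
      using xy(3) by (rule less_exp_cong_floor)
    then show "v x = v y"
      using xy by (simp add: v_def walsh_fourier_dyadic_step[OF s])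
  qed (auto simp: v_def split: if_splits)
  show "square_integrable Rplus v"
    by (rule dyadic_step_square_integrable(1)[OF v])
  let ?S = "\<lambda>l. \<Sum>k<2 ^ (2 * n). s (real k / 2 ^ n) * complex_of_real (hadamard (2 * n) l k)"
  have "(L2_norm Rplus v)\<^sup>2 = (\<Sum>l<2 ^ (2 * n). (cmod (v (real l / 2 ^ n)))\<^sup>2) / 2 ^ n"
    by (rule dyadic_step_square_integrable(2)[OF v])
  also have "(\<Sum>l<2 ^ (2 * n). (cmod (v (real l / 2 ^ n)))\<^sup>2) = (\<Sum>l<2 ^ (2 * n). (cmod (?S l))\<^sup>2 / 2 ^ (2 * n))"
  proof (intro sum.cong refl)
    fix l :: nat assume "l \<in> {..<2 ^ (2 * n)}"
    then have "real l < real (2 ^ (2 * n))"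
      by (simp only: lessThan_iff of_nat_less_iff)
    then have "real l / 2 ^ n < 2 ^ n"
      by (simp add: pos_divide_less_eq mult_2 power_add)
    then have "v (real l / 2 ^ n) = ?S l / 2 ^ n"
      by (simp add: v_def walsh_fourier_dyadic_step[OF s])
    then show "(cmod (v (real l / 2 ^ n)))\<^sup>2 = (cmod (?S l))\<^sup>2 / 2 ^ (2 * n)"
      by (simp add: norm_divide norm_power power_divide power_even_eq)
  qed
  also have "\<dots> = (\<Sum>k<2 ^ (2 * n). (cmod (s (real k / 2 ^ n)))\<^sup>2)"
    by (simp add: hadamard_Parseval flip: sum_divide_distrib)
  also have "\<dots> / 2 ^ n = (L2_norm Rplus s)\<^sup>2"
    by (rule dyadic_step_square_integrable(2)[OF s, symmetric])
  finally show "L2_norm Rplus v = L2_norm Rplus s"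
    by simp
qed

text \<open>A step function of level \<open>n\<close> is also one of every level
  \<open>n + m\<close>, so the truncations of the transform to \<open>[0, 2 ^ (n + m))\<close> all
  have the norm of \<open>s\<close>. Fatou along \<open>m\<close> bounds the full transform from
  above, and its truncation at \<open>m = 0\<close> bounds it from below.\<close>

lemma Plancherel_dyadic_step:
  assumes s: "dyadic_step n s"
  shows "square_integrable Rplus (walsh_fourier_L1 s)"
    and "L2_norm Rplus (walsh_fourier_L1 s) = L2_norm Rplus s"
proof -
  define v where "v m t = (if 0 \<le> t \<and> t < 2 ^ (n + m) then walsh_fourier_L1 s t else 0)" for m t
  have v: "square_integrable Rplus (v m)" "L2_norm Rplus (v m) = L2_norm Rplus s" for m
    unfolding v_def using walsh_fourier_dyadic_step_trunc[OF dyadic_step_mono[OF s, of "n + m"]]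
    by auto
  have lim: "(\<lambda>m. v m t) \<longlonglongrightarrow> walsh_fourier_L1 s t" if "t \<in> space Rplus" for t
  proof (rule tendsto_eventually)
    obtain m0 where m0: "t < 2 ^ m0" using real_arch_pow[of 2 t] by auto
    have "v m t = walsh_fourier_L1 s t" if "m0 \<le> m" for m
    proof -
      have "(2::real) ^ m0 \<le> 2 ^ (n + m)" using that by (intro power_increasing) auto
      then have "t < 2 ^ (n + m)" using m0 by linarith
      then show ?thesis
        using \<open>t \<in> space Rplus\<close> by (simp add: v_def space_restrict_space)
    qed
    then show "\<forall>\<^sub>F m in sequentially. v m t = walsh_fourier_L1 s t"
      by (auto simp: eventually_sequentially)
  qed
  have meas: "walsh_fourier_L1 s \<in> borel_measurable Rplus"
    by (rule borel_measurable_LIMSEQ_metric[of v]) (use v(1) lim in auto)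
  have ae: "AE t in Rplus. (\<lambda>m. v m t) \<longlonglongrightarrow> walsh_fourier_L1 s t"
    using lim by (rule AE_I2)
  have bound: "\<forall>\<^sub>F m in sequentially. L2_norm Rplus (v m) \<le> L2_norm Rplus s"
    by (simp add: v(2))
  note * = Fatou_L2[OF v(1) meas ae bound]
  show "square_integrable Rplus (walsh_fourier_L1 s)" by (fact *(1))
  have "L2_norm Rplus (v 0) \<le> L2_norm Rplus (walsh_fourier_L1 s)"
    by (rule square_integrable_mono(2)[OF *(1)]) (use v(1) in \<open>auto simp: v_def\<close>)
  with *(2) show "L2_norm Rplus (walsh_fourier_L1 s) = L2_norm Rplus s"
    by (simp add: v(2))
qed

section \<open>Density of dyadic step functions\<close>

lemma borel_measurable_Rplus: "f \<in> borel_measurable borel \<Longrightarrow> f \<in> borel_measurable Rplus"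
  by (intro measurable_restrict_space1 measurable_completion) simp

lemma Rplus_ident [measurable]: "(\<lambda>x. x) \<in> borel_measurable Rplus"
  by (rule borel_measurable_Rplus) simp

lemma dominated_convergence_L1:
  fixes F :: "nat \<Rightarrow> 'a \<Rightarrow> complex"
  assumes [measurable]: "\<And>n. F n \<in> borel_measurable M" "f \<in> borel_measurable M"
    and h: "integrable M (\<lambda>x. h x :: real)"
    and lim: "AE x in M. (\<lambda>n. F n x) \<longlonglongrightarrow> f x"
    and bound: "\<And>n. AE x in M. cmod (F n x) \<le> h x"
  shows "(\<lambda>n. LINT x|M. cmod (F n x - f x)) \<longlonglongrightarrow> 0"
proof -
  have all: "AE x in M. \<forall>n. cmod (F n x) \<le> h x"
    using bound by (simp add: AE_all_countable)
  then have fh: "AE x in M. cmod (f x) \<le> h x"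
    using lim
  proof eventually_elim
    case (elim x)
    show ?case
      by (rule LIMSEQ_le_const2[OF tendsto_norm[OF elim(2)]]) (use elim(1) in auto)
  qed
  have "(\<lambda>n. LINT x|M. cmod (F n x - f x)) \<longlonglongrightarrow> (LINT x|M. 0)"
  proof (rule integral_dominated_convergence[where w = "\<lambda>x. 2 * h x"])
    show "AE x in M. (\<lambda>n. cmod (F n x - f x)) \<longlonglongrightarrow> 0"
      using lim by eventually_elim (simp add: LIM_zero tendsto_norm_zero)
    show "AE x in M. norm (cmod (F n x - f x)) \<le> 2 * h x" for n
      using all fh
    proof eventually_elim
      case (elim x)
      have "cmod (F n x) \<le> h x" using elim(1) by blast
      with elim(2) norm_triangle_ineq4[of "F n x" "f x"] show ?case
        by (simp only: real_norm_def abs_norm_cancel)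
    qed
  qed (use h in auto)
  then show ?thesis by simp
qed

lemma dominated_convergence_L2:
  fixes F :: "nat \<Rightarrow> 'a \<Rightarrow> complex"
  assumes [measurable]: "\<And>n. F n \<in> borel_measurable M" "f \<in> borel_measurable M"
    and h: "integrable M (\<lambda>x. (h x :: real)\<^sup>2)"
    and lim: "AE x in M. (\<lambda>n. F n x) \<longlonglongrightarrow> f x"
    and bound: "\<And>n. AE x in M. cmod (F n x) \<le> h x"
  shows "(\<lambda>n. L2_norm M (\<lambda>x. F n x - f x)) \<longlonglongrightarrow> 0"
proof -
  have all: "AE x in M. \<forall>n. cmod (F n x) \<le> h x"
    using bound by (simp add: AE_all_countable)
  then have fh: "AE x in M. cmod (f x) \<le> h x"
    using lim
  proof eventually_elim
    case (elim x)
    show ?case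
      by (rule LIMSEQ_le_const2[OF tendsto_norm[OF elim(2)]]) (use elim(1) in auto)
  qed
  have "(\<lambda>n. LINT x|M. (cmod (F n x - f x))\<^sup>2) \<longlonglongrightarrow> (LINT x|M. 0)"
  proof (rule integral_dominated_convergence[where w = "\<lambda>x. 4 * (h x)\<^sup>2"])
    show "AE x in M. (\<lambda>n. (cmod (F n x - f x))\<^sup>2) \<longlonglongrightarrow> 0"
      using lim
    proof eventually_elim
      case (elim x)
      then have "(\<lambda>n. cmod (F n x - f x)) \<longlonglongrightarrow> 0"
        by (simp add: LIM_zero tendsto_norm_zero)
      from tendsto_power[OF this, of 2] show ?case by simp
    qed
    show "AE x in M. norm ((cmod (F n x - f x))\<^sup>2) \<le> 4 * (h x)\<^sup>2" for n
      using all fh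
    proof eventually_elim
      case (elim x)
      then have "cmod (F n x - f x) \<le> 2 * h x"
        using norm_triangle_ineq4[of "F n x" "f x"] spec[OF elim(1), of n] by linarith
      then have "(cmod (F n x - f x))\<^sup>2 \<le> (2 * h x)\<^sup>2"
        by (rule power_mono) simp
      then show ?case by (simp add: power_mult_distrib)
    qed
  qed (use h in auto)
  then show ?thesis
    unfolding L2_norm_def using tendsto_real_sqrt by fastforce
qed

text \<open>One step function has to serve both norms: closeness in \<open>L1\<close> controls the
  transforms pointwise, closeness in \<open>L2\<close> controls their norms.\<close>

definition step_approximable :: "(real \<Rightarrow> complex) \<Rightarrow> bool" where
  "step_approximable F \<longleftrightarrow> integrable Rplus F \<and> square_integrable Rplus F \<and>
     (\<forall>e>0. \<exists>n s. dyadic_step n s \<and>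
        (LINT x|Rplus. cmod (s x - F x)) < e \<and> L2_norm Rplus (\<lambda>x. s x - F x) < e)"

lemma step_approximable_dyadic_step: "dyadic_step n s \<Longrightarrow> step_approximable s"
  unfolding step_approximable_def
  using dyadic_step_square_integrable(1)[of n s] dyadic_step_integral[of n s]
  by (auto intro!: exI[of _ s] simp: L2_norm_def has_bochner_integral_iff)

text \<open>The closure property behind every density result here. A single majorant in
  \<open>L1 \<inter> L2\<close> gives convergence in both norms at once, after which an
  \<open>e / 2\<close> argument applies.\<close>

lemma step_approximable_dominated:
  assumes F: "\<And>n. step_approximable (F n)" and f: "f \<in> borel_measurable Rplus"
    and h: "integrable Rplus h" "integrable Rplus (\<lambda>x. (h x)\<^sup>2)"
    and lim: "AE x in Rplus. (\<lambda>n. F n x) \<longlonglongrightarrow> f x"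
    and bound: "\<And>n x. x \<ge> 0 \<Longrightarrow> cmod (F n x) \<le> h x"
  shows "step_approximable f"
proof -
  have Fi: "integrable Rplus (F n)" and F2: "square_integrable Rplus (F n)" for n
    using F[of n] by (auto simp: step_approximable_def)
  have meas: "F n \<in> borel_measurable Rplus" for n
    using Fi by auto
  have ae: "AE x in Rplus. cmod (F n x) \<le> h x" for n
    using bound by (auto intro!: AE_I2 simp: space_restrict_space)
  have all: "AE x in Rplus. \<forall>n. cmod (F n x) \<le> h x"
    using ae by (simp add: AE_all_countable)
  have fh: "AE x in Rplus. cmod (f x) \<le> h x"
    using lim
  proof (rule AE_mp)
    show "AE x in Rplus. (\<lambda>n. F n x) \<longlonglongrightarrow> f x \<longrightarrow> cmod (f x) \<le> h x"
      using bound by (intro AE_I2 impI) (auto simp: space_restrict_space intro: LIMSEQ_le_const2[OF tendsto_norm])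
  qed
  have fi: "integrable Rplus f"
    by (rule Bochner_Integration.integrable_bound[OF h(1) f]) (use fh in \<open>eventually_elim, simp\<close>)
  have "AE x in Rplus. norm ((cmod (f x))\<^sup>2) \<le> norm ((h x)\<^sup>2)"
    using fh by eventually_elim (simp add: power_mono)
  then have f2: "square_integrable Rplus f"
    unfolding square_integrable_def using f
    by (auto intro: Bochner_Integration.integrable_bound[OF h(2)])
  note L1 = dominated_convergence_L1[OF meas f h(1) lim ae]
  note L2 = dominated_convergence_L2[OF meas f h(2) lim ae]
  show ?thesis
    unfolding step_approximable_def
  proof (intro conjI fi f2 allI impI)
    fix e :: real assume "e > 0"
    then have e: "e / 2 > 0" by simp
    have "\<forall>\<^sub>F n in sequentially. (LINT x|Rplus. cmod (F n x - f x)) < e / 2 \<and>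
        L2_norm Rplus (\<lambda>x. F n x - f x) < e / 2"
      by (intro eventually_conj order_tendstoD(2)[OF L1 e] order_tendstoD(2)[OF L2 e])
    then obtain N where N: "(LINT x|Rplus. cmod (F N x - f x)) < e / 2" "L2_norm Rplus (\<lambda>x. F N x - f x) < e / 2"
      by (auto simp: eventually_sequentially)
    obtain n s where s: "dyadic_step n s" "(LINT x|Rplus. cmod (s x - F N x)) < e / 2"
      "L2_norm Rplus (\<lambda>x. s x - F N x) < e / 2"
      using F[of N] e unfolding step_approximable_def by blast
    have si: "integrable Rplus s" "square_integrable Rplus s"
      using dyadic_step_square_integrable(1)[OF s(1)] dyadic_step_integral[OF s(1)]
      by (auto simp: has_bochner_integral_iff)
    have "(LINT x|Rplus. cmod (s x - f x)) \<le> (LINT x|Rplus. cmod (s x - F N x) + cmod (F N x - f x))"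
      using si(1) Fi[of N] fi norm_triangle_ineq[of "s x - F N x" "F N x - f x" for x]
      by (intro integral_mono) auto
    also have "\<dots> = (LINT x|Rplus. cmod (s x - F N x)) + (LINT x|Rplus. cmod (F N x - f x))"
      using si(1) Fi[of N] fi by (intro Bochner_Integration.integral_add) auto
    finally have "(LINT x|Rplus. cmod (s x - f x)) < e"
      using s(2) N(1) by linarith
    moreover have "L2_norm Rplus (\<lambda>x. s x - f x) < e"
      using L2_norm_diff_triangle[OF si(2) F2[of N] f2] s(3) N(2) by linarith
    ultimately show "\<exists>n s. dyadic_step n s \<and> (LINT x|Rplus. cmod (s x - f x)) < e \<and>
        L2_norm Rplus (\<lambda>x. s x - f x) < e"
      using s(1) by blast
  qed
qed

lemma integrable_cutoff:
  fixes B :: real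
  shows "integrable Rplus (\<lambda>x. if x < 2 ^ N then B else 0)"
proof -
  have "integrable Rplus (\<lambda>x. indicator {0..<2 ^ N} x *\<^sub>R B)"
  proof (intro integrable_scaleR_left integrable_real_indicator)
    show "{0..<2 ^ N :: real} \<in> sets Rplus"
      unfolding sets_restrict_space by (auto intro!: image_eqI[where x = "{0..<2 ^ N}"])
    have "emeasure Rplus {0..<2 ^ N :: real} = emeasure lebesgue {0..<2 ^ N :: real}"
      by (subst emeasure_restrict_space) auto
    also have "\<dots> < \<infinity>" by simp
    finally show "emeasure Rplus {0..<2 ^ N :: real} < \<infinity>" .
  qed
  then show ?thesis
    by (rule Bochner_Integration.integrable_cong[THEN iffD1, rotated 2])
      (auto simp: space_restrict_space indicator_def)
qed

lemma step_approximable_cutoff: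
  fixes B :: real
  assumes F: "\<And>n. step_approximable (F n)" and f: "f \<in> borel_measurable Rplus"
    and lim: "AE x in Rplus. (\<lambda>n. F n x) \<longlonglongrightarrow> f x"
    and bound: "\<And>n x. x \<ge> 0 \<Longrightarrow> cmod (F n x) \<le> (if x < 2 ^ N then B else 0)"
  shows "step_approximable f"
proof (rule step_approximable_dominated[OF F f _ _ lim bound])
  have "(\<lambda>x. (if x < 2 ^ N then B else 0)\<^sup>2) = (\<lambda>x::real. if x < 2 ^ N then B\<^sup>2 else 0)"
    by auto
  then show "integrable Rplus (\<lambda>x. (if x < 2 ^ N then B else 0)\<^sup>2)"
    by (simp only: integrable_cutoff)
qed (rule integrable_cutoff)

text \<open>The step functions sample \<open>g\<close> at the left endpoint of each cell of length
  \<open>2 ^ (-(N + k))\<close>; these endpoints tend to \<open>x\<close>, so continuity gives the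
  limit.\<close>

lemma step_approximable_continuous:
  fixes g :: "real \<Rightarrow> complex"
  assumes g: "continuous_on UNIV g" and bound: "\<And>x. cmod (g x) \<le> B"
  shows "step_approximable (\<lambda>x. if 0 \<le> x \<and> x < 2 ^ N then g x else 0)"
proof (rule step_approximable_cutoff)
  let ?S = "\<lambda>k (x::real). if 0 \<le> x \<and> x < 2 ^ N then g (real_of_int \<lfloor>x * 2 ^ (N + k)\<rfloor> / 2 ^ (N + k)) else 0"
  have "dyadic_step (N + k) (?S k)" for k
    unfolding dyadic_step_def
  proof (intro conjI allI impI)
    fix x y :: real
    assume xy: "0 \<le> x" "0 \<le> y" "\<lfloor>x * 2 ^ (N + k)\<rfloor> = \<lfloor>y * 2 ^ (N + k)\<rfloor>"
    have "x < 2 ^ N \<longleftrightarrow> y < 2 ^ N"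
      using xy(3) by (rule less_exp_cong_floor)
    then show "?S k x = ?S k y"
      using xy by simp
  next
    fix x assume x: "?S k x \<noteq> 0"
    have "(2::real) ^ N \<le> 2 ^ (N + k)" by (intro power_increasing) auto
    moreover have "0 \<le> x \<and> x < 2 ^ N" using x by presburger
    ultimately show "0 \<le> x" "x < 2 ^ (N + k)"
      by linarith+
  qed
  then show "step_approximable (?S k)" for k
    by (rule step_approximable_dyadic_step)
  have [measurable]: "g \<in> borel_measurable borel"
    using g by (rule borel_measurable_continuous_onI)
  show "(\<lambda>x. if 0 \<le> x \<and> x < 2 ^ N then g x else 0) \<in> borel_measurable Rplus"
    by (rule borel_measurable_Rplus) measurable
  show "AE x in Rplus. (\<lambda>k. ?S k x) \<longlonglongrightarrow> (if 0 \<le> x \<and> x < 2 ^ N then g x else 0)"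
  proof (rule AE_I2)
    fix x :: real
    have "(\<lambda>k. real_of_int \<lfloor>x * 2 ^ (N + k)\<rfloor> / 2 ^ (N + k)) \<longlonglongrightarrow> x"
    proof (rule LIM_zero_cancel, rule Lim_null_comparison)
      have "\<bar>real_of_int \<lfloor>x * 2 ^ m\<rfloor> / 2 ^ m - x\<bar> \<le> (1/2) ^ m" for m
      proof -
        have "\<bar>real_of_int \<lfloor>x * 2 ^ m\<rfloor> - x * 2 ^ m\<bar> \<le> 1" by linarith
        then have "\<bar>real_of_int \<lfloor>x * 2 ^ m\<rfloor> - x * 2 ^ m\<bar> / 2 ^ m \<le> 1 / 2 ^ m"
          by (intro divide_right_mono) auto
        also have "\<bar>real_of_int \<lfloor>x * 2 ^ m\<rfloor> - x * 2 ^ m\<bar> / 2 ^ m = \<bar>(real_of_int \<lfloor>x * 2 ^ m\<rfloor> - x * 2 ^ m) / 2 ^ m\<bar>"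
          by (simp add: abs_divide)
        also have "(real_of_int \<lfloor>x * 2 ^ m\<rfloor> - x * 2 ^ m) / 2 ^ m = real_of_int \<lfloor>x * 2 ^ m\<rfloor> / 2 ^ m - x"
          by (simp add: diff_divide_distrib)
        finally show ?thesis by (simp add: power_one_over)
      qed
      then show "\<forall>\<^sub>F k in sequentially. norm (real_of_int \<lfloor>x * 2 ^ (N + k)\<rfloor> / 2 ^ (N + k) - x) \<le> (1/2) ^ (N + k)"
        by simp
      have "(\<lambda>k. (1/2::real) ^ k) \<longlonglongrightarrow> 0" by (rule LIMSEQ_power_zero) simp
      from LIMSEQ_ignore_initial_segment[OF this, of N]
      show "(\<lambda>k. (1/2::real) ^ (N + k)) \<longlonglongrightarrow> 0" by (simp add: add.commute)
    qed
    moreover have "isCont g x"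
      using g by (simp add: continuous_on_eq_continuous_at)
    ultimately have "(\<lambda>k. g (real_of_int \<lfloor>x * 2 ^ (N + k)\<rfloor> / 2 ^ (N + k))) \<longlonglongrightarrow> g x"
      by (rule isCont_tendsto_compose[rotated])
    then show "(\<lambda>k. ?S k x) \<longlonglongrightarrow> (if 0 \<le> x \<and> x < 2 ^ N then g x else 0)"
      by (cases "0 \<le> x \<and> x < 2 ^ N") (simp, simp only: if_False tendsto_const)
  qed
  show "cmod (?S k x) \<le> (if x < 2 ^ N then B else 0)" for k x
    using bound order_trans[OF norm_ge_zero bound] by auto
qed

text \<open>\<open>measurable_on\<close> supplies continuous functions converging to
  \<open>F\<close> off a negligible set. They need not be uniformly bounded, so each is first pushed
  into the disc of radius \<open>B\<close>.\<close>

lemma step_approximable_bounded: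
  fixes F :: "real \<Rightarrow> complex"
  assumes F: "F \<in> borel_measurable Rplus" and B: "B > 0" "\<And>x. cmod (F x) \<le> B"
    and supp: "\<And>x. x \<ge> 2 ^ N \<Longrightarrow> F x = 0"
  shows "step_approximable F"
proof -
  have "F measurable_on {0..}"
    using F by (simp add: measurable_on_iff_borel_measurable)
  then obtain Z g where Z: "negligible Z" and g: "\<And>n. continuous_on UNIV (g n)"
    and lim: "\<And>x. x \<notin> Z \<Longrightarrow> (\<lambda>n. g n x) \<longlonglongrightarrow> (if x \<in> {0..} then F x else 0)"
    unfolding measurable_on_def by blast
  \<comment> \<open>The radial retraction onto the closed disc of radius \<open>B\<close>: it is
    continuous and fixes the values of \<open>F\<close>, so the limit is unchanged. Here
    \<open>B > 0\<close> keeps the denominator away from 0.\<close>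
  define c where "c z = z * complex_of_real (B / max B (cmod z))" for z
  have c_cont: "continuous_on UNIV c"
    unfolding c_def using B(1) by (intro continuous_intros) auto
  have c_bound: "cmod (c z) \<le> B" for z
    using B(1) by (simp add: c_def norm_mult norm_divide pos_divide_le_eq mult_left_mono)
  have c_id: "c z = z" if "cmod z \<le> B" for z
    using that B(1) by (simp add: c_def max_def)
  show ?thesis
  proof (rule step_approximable_cutoff)
    have "continuous_on UNIV (\<lambda>x. c (g n x))" for n
      by (rule continuous_on_compose2[OF c_cont g]) simp
    then show "step_approximable (\<lambda>x. if 0 \<le> x \<and> x < 2 ^ N then c (g n x) else 0)" for n
      by (rule step_approximable_continuous) (rule c_bound)
    have "AE x in lebesgue. x \<notin> Z"
      using Z by (simp add: negligible_iff_null_sets AE_not_in)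
    then have "AE x in Rplus. x \<notin> Z"
      by (subst AE_restrict_space_iff) auto
    then show "AE x in Rplus. (\<lambda>n. if 0 \<le> x \<and> x < 2 ^ N then c (g n x) else 0) \<longlonglongrightarrow> F x"
    proof (rule AE_mp, intro AE_I2 impI)
      fix x assume x: "x \<in> space Rplus" "x \<notin> Z"
      then have "(\<lambda>n. g n x) \<longlonglongrightarrow> F x"
        using lim[of x] by (simp add: space_restrict_space)
      moreover have "isCont c (F x)"
        using c_cont by (simp add: continuous_on_eq_continuous_at)
      ultimately have "(\<lambda>n. c (g n x)) \<longlonglongrightarrow> F x"
        using isCont_tendsto_compose c_id[OF B(2)] by metis
      then show "(\<lambda>n. if 0 \<le> x \<and> x < 2 ^ N then c (g n x) else 0) \<longlonglongrightarrow> F x"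
        using x supp[of x] by (cases "x < 2 ^ N") (simp_all add: space_restrict_space)
    qed
    show "cmod (if 0 \<le> x \<and> x < 2 ^ N then c (g n x) else 0) \<le> (if x < 2 ^ N then B else 0)" for n x
      using c_bound B(1) by auto
  qed (rule F)
qed

section \<open>Truncation in support and in size\<close>

definition truncation :: "(real \<Rightarrow> complex) \<Rightarrow> nat \<Rightarrow> real \<Rightarrow> complex" where
  "truncation F n x = (if x < 2 ^ n \<and> cmod (F x) \<le> 1 + real n then F x else 0)"

lemma truncation_tendsto: "(\<lambda>n. truncation F n x) \<longlonglongrightarrow> F x"
proof (rule tendsto_eventually)
  obtain a where a: "x < 2 ^ a" using real_arch_pow[of 2 x] by auto
  obtain b :: nat where b: "cmod (F x) \<le> real b" using real_arch_simple by blast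
  have "truncation F n x = F x" if "max a b \<le> n" for n
  proof -
    have "(2::real) ^ a \<le> 2 ^ n" using that by (intro power_increasing) auto
    then have "x < 2 ^ n" "cmod (F x) \<le> 1 + real n"
      using a b that by linarith+
    then show ?thesis
      by (simp add: truncation_def)
  qed
  then show "\<forall>\<^sub>F n in sequentially. truncation F n x = F x"
    unfolding eventually_sequentially by blast
qed

lemma truncation_measurable [measurable]:
  assumes [measurable]: "F \<in> borel_measurable Rplus"
  shows "truncation F n \<in> borel_measurable Rplus"
  unfolding truncation_def by measurable

lemma step_approximable_truncation:
  assumes "F \<in> borel_measurable Rplus"
  shows "step_approximable (truncation F n)"
  \<comment> \<open>The summand 1 keeps the bound positive at \<open>n = 0\<close>, as the
    retraction onto a disc requires.\<close>
  by (rule step_approximable_bounded[where B = "1 + real n" and N = n, OF truncation_measurable[OF assms]])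
    (auto simp: truncation_def)

text \<open>\<open>cmod (F x)\<close> itself is an admissible majorant of the truncations, being
  both integrable and square integrable.\<close>

lemma step_approximable_L1_L2:
  assumes "integrable Rplus F" "square_integrable Rplus F"
  shows "step_approximable F"
proof (rule step_approximable_dominated)
  show "step_approximable (truncation F n)" for n
    using assms by (intro step_approximable_truncation) auto
  show "AE x in Rplus. (\<lambda>n. truncation F n x) \<longlonglongrightarrow> F x"
    by (intro AE_I2 truncation_tendsto)
  show "cmod (truncation F n x) \<le> cmod (F x)" for n x
    by (simp add: truncation_def)
qed (use assms in auto)

lemma L1_L2_dense_in_L2:
  assumes f: "square_integrable Rplus f" and "e > 0"
  obtains G where "integrable Rplus G" "square_integrable Rplus G" "L2_norm Rplus (\<lambda>x. G x - f x) < e"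
proof -
  have fm: "f \<in> borel_measurable Rplus" using f by auto
  have "(\<lambda>n. L2_norm Rplus (\<lambda>x. truncation f n x - f x)) \<longlonglongrightarrow> 0"
    by (rule dominated_convergence_L2[where h = "\<lambda>x. cmod (f x)"])
      (use f fm in \<open>auto intro!: AE_I2 truncation_tendsto truncation_measurable\<close>,
        simp add: truncation_def)
  from order_tendstoD(2)[OF this \<open>e > 0\<close>]
  obtain n where "L2_norm Rplus (\<lambda>x. truncation f n x - f x) < e"
    by (auto simp: eventually_sequentially)
  moreover have "step_approximable (truncation f n)"
    by (rule step_approximable_truncation[OF fm])
  ultimately show ?thesis
    using that[of "truncation f n"] by (simp add: step_approximable_def)
qed

section \<open>Plancherel's theorem\<close>

lemma dyadic_step_diff:
  fixes r s :: "real \<Rightarrow> 'a::group_add"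
  assumes r: "dyadic_step n r" and s: "dyadic_step n s"
  shows "dyadic_step n (\<lambda>x. r x - s x)"
  unfolding dyadic_step_def
proof (intro conjI allI impI)
  fix x y :: real
  assume "0 \<le> x" "0 \<le> y" "\<lfloor>x * 2 ^ n\<rfloor> = \<lfloor>y * 2 ^ n\<rfloor>"
  then show "r x - s x = r y - s y"
    using dyadic_step_cong_floor[OF r, of x y] dyadic_step_cong_floor[OF s, of x y] by simp
qed (use dyadic_step_zero[OF r] dyadic_step_zero[OF s] in force)+

text \<open>Cut off at \<open>2 ^ (n0 + n)\<close>, the function \<open>walsh t\<close> is a dyadic
  step function, and the cutoffs converge pointwise.\<close>

lemma walsh_measurable:
  assumes t: "t \<ge> 0"
  shows "walsh t \<in> borel_measurable Rplus"
proof -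
  obtain n0 where n0: "t < 2 ^ n0" using real_arch_pow[of 2 t] by auto
  define v where "v n x = (if 0 \<le> x \<and> x < 2 ^ (n0 + n) then walsh t x else 0)" for n x
  have tn: "t < 2 ^ (n0 + n)" for n
  proof -
    have "(2::real) ^ n0 \<le> 2 ^ (n0 + n)" by (intro power_increasing) auto
    then show ?thesis using n0 by linarith
  qed
  have "dyadic_step (n0 + n) (v n)" for n
    unfolding dyadic_step_def
  proof (intro conjI allI impI)
    fix x y :: real
    assume xy: "0 \<le> x" "0 \<le> y" "\<lfloor>x * 2 ^ (n0 + n)\<rfloor> = \<lfloor>y * 2 ^ (n0 + n)\<rfloor>"
    have "x < 2 ^ (n0 + n) \<longleftrightarrow> y < 2 ^ (n0 + n)"
      using xy(3) by (rule less_exp_cong_floor)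
    then show "v n x = v n y"
      using xy by (cases "y < 2 ^ (n0 + n)") (simp_all add: v_def walsh_eq_hadamard[OF t tn])
  qed (auto simp: v_def split: if_splits)
  then have v: "v n \<in> borel_measurable Rplus" for n
    using dyadic_step_integral[of "n0 + n" "v n"] by (auto simp: has_bochner_integral_iff)
  have lim: "(\<lambda>n. v n x) \<longlonglongrightarrow> walsh t x" if "x \<in> space Rplus" for x
  proof (rule tendsto_eventually)
    obtain m where m: "x < 2 ^ m" using real_arch_pow[of 2 x] by auto
    have "v n x = walsh t x" if "m \<le> n" for n
    proof -
      have "(2::real) ^ m \<le> 2 ^ (n0 + n)" using that by (intro power_increasing) auto
      then have "x < 2 ^ (n0 + n)" using m by linarith
      then show ?thesis
        using \<open>x \<in> space Rplus\<close> by (simp add: v_def space_restrict_space)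
    qed
    then show "\<forall>\<^sub>F n in sequentially. v n x = walsh t x"
      unfolding eventually_sequentially by blast
  qed
  show ?thesis
    by (rule borel_measurable_LIMSEQ_metric[of v]) (use v lim in auto)
qed

lemma integrable_mult_walsh:
  assumes "integrable Rplus F" "t \<ge> 0"
  shows "integrable Rplus (\<lambda>x. F x * complex_of_real (walsh t x))"
proof (rule Bochner_Integration.integrable_bound[OF assms(1)])
  have [measurable]: "walsh t \<in> borel_measurable Rplus" "F \<in> borel_measurable Rplus"
    using walsh_measurable[OF assms(2)] assms(1) by auto
  show "(\<lambda>x. F x * complex_of_real (walsh t x)) \<in> borel_measurable Rplus"
    by measurable
qed (simp add: norm_mult)

lemma walsh_fourier_L1_diff:
  assumes "integrable Rplus F" "integrable Rplus G" "t \<ge> 0"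
  shows "walsh_fourier_L1 (\<lambda>x. F x - G x) t = walsh_fourier_L1 F t - walsh_fourier_L1 G t"
  unfolding walsh_fourier_L1_def
  using Bochner_Integration.integral_diff[OF integrable_mult_walsh[OF assms(1,3)] integrable_mult_walsh[OF assms(2,3)]]
  by (simp add: left_diff_distrib)

lemma norm_walsh_fourier_L1_le:
  assumes "integrable Rplus F" "t \<ge> 0"
  shows "cmod (walsh_fourier_L1 F t) \<le> (LINT x|Rplus. cmod (F x))"
  unfolding walsh_fourier_L1_def
  by (rule order_trans[OF integral_norm_bound]) (simp add: norm_mult)

text \<open>\<open>L1\<close> approximation identifies the pointwise limit of the transforms of the
  step functions as the transform of \<open>F\<close>. Plancherel for steps makes those transforms
  Cauchy in \<open>L2\<close>, and Fatou shows that the two limits agree.\<close>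

theorem Plancherel_L1_L2:
  assumes F: "integrable Rplus F" "square_integrable Rplus F"
  shows "square_integrable Rplus (walsh_fourier_L1 F)"
    and "L2_norm Rplus (walsh_fourier_L1 F) = L2_norm Rplus F"
proof -
  have "\<exists>s k. dyadic_step k s \<and> (LINT x|Rplus. cmod (s x - F x)) < (1/2) ^ n \<and>
      L2_norm Rplus (\<lambda>x. s x - F x) < (1/2) ^ n" for n :: nat
  proof -
    have "(0::real) < (1/2) ^ n" by simp
    then show ?thesis
      using step_approximable_L1_L2[OF F] unfolding step_approximable_def by blast
  qed
  then obtain S K where S: "\<And>n. dyadic_step (K n) (S n)"
    and S1: "\<And>n. (LINT x|Rplus. cmod (S n x - F x)) < (1/2) ^ n"
    and S2: "\<And>n. L2_norm Rplus (\<lambda>x. S n x - F x) < (1/2) ^ n"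
    by metis
  have Si: "integrable Rplus (S n)" "square_integrable Rplus (S n)" for n
    using dyadic_step_square_integrable(1)[OF S] dyadic_step_integral[OF S]
    by (auto simp: has_bochner_integral_iff)
  let ?S = "\<lambda>n. walsh_fourier_L1 (S n)" and ?F = "walsh_fourier_L1 F"
  have TS: "square_integrable Rplus (?S n)" "L2_norm Rplus (?S n) = L2_norm Rplus (S n)" for n
    using Plancherel_dyadic_step[OF S] by auto
  have half: "(\<lambda>n. (1/2::real) ^ n) \<longlonglongrightarrow> 0"
    by (rule LIMSEQ_power_zero) simp
  have lim: "(\<lambda>n. ?S n t) \<longlonglongrightarrow> ?F t" if "t \<ge> 0" for t
  proof (rule LIM_zero_cancel, rule Lim_null_comparison[OF _ half])
    have "cmod (?S n t - ?F t) \<le> (1/2) ^ n" for n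
      using norm_walsh_fourier_L1_le[OF Bochner_Integration.integrable_diff[OF Si(1)[of n] F(1)] that]
        walsh_fourier_L1_diff[OF Si(1)[of n] F(1) that] S1[of n] by simp
    then show "\<forall>\<^sub>F n in sequentially. cmod (?S n t - ?F t) \<le> (1/2) ^ n"
      by simp
  qed
  have meas: "?F \<in> borel_measurable Rplus"
    by (rule borel_measurable_LIMSEQ_metric[of ?S]) (use TS(1) lim in \<open>auto simp: space_restrict_space\<close>)
  have "L2_norm Rplus (S n) \<le> L2_norm Rplus F + 1" for n
    using L2_norm_triangle[OF Si(2)[of n] F(2)] S2[of n] power_le_one[of "1/2::real" n] by simp
  then have bound: "\<forall>\<^sub>F n in sequentially. L2_norm Rplus (?S n) \<le> L2_norm Rplus F + 1"
    by (simp add: TS(2))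
  have ae: "AE t in Rplus. (\<lambda>n. ?S n t) \<longlonglongrightarrow> ?F t"
    using lim by (intro AE_I2) (simp add: space_restrict_space)
  show TF: "square_integrable Rplus ?F"
    by (rule Fatou_L2(1)[OF TS(1) meas ae bound])
  \<comment> \<open>Fatou in \<open>k\<close> with \<open>n\<close> fixed upgrades pointwise
    convergence of the transforms to convergence in norm.\<close>
  have dist: "L2_norm Rplus (\<lambda>t. ?F t - ?S n t) \<le> 2 * (1/2) ^ n" for n
  proof (rule Fatou_L2(2))
    show "square_integrable Rplus (\<lambda>t. ?S k t - ?S n t)" for k
      by (intro square_integrable_diff TS)
    show "(\<lambda>t. ?F t - ?S n t) \<in> borel_measurable Rplus"
      using square_integrable_diff[OF TF TS(1)[of n]] by auto
    show "AE t in Rplus. (\<lambda>k. ?S k t - ?S n t) \<longlonglongrightarrow> ?F t - ?S n t"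
      using ae by eventually_elim (intro tendsto_intros)
    have "L2_norm Rplus (\<lambda>t. ?S k t - ?S n t) \<le> 2 * (1/2) ^ n" if "n \<le> k" for k
    proof -
      \<comment> \<open>\<open>S k\<close> and \<open>S n\<close> may live on different grids; on
        the finer one their difference is a single step function, to which Plancherel
        applies.\<close>
      have step: "dyadic_step (max (K k) (K n)) (\<lambda>x. S k x - S n x)"
        by (intro dyadic_step_diff dyadic_step_mono[OF S]) auto
      have "L2_norm Rplus (\<lambda>t. ?S k t - ?S n t) = L2_norm Rplus (walsh_fourier_L1 (\<lambda>x. S k x - S n x))"
        unfolding L2_norm_def using walsh_fourier_L1_diff[OF Si(1)[of k] Si(1)[of n]]
        by (intro arg_cong[where f = sqrt] Bochner_Integration.integral_cong) (auto simp: space_restrict_space)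
      also have "\<dots> = L2_norm Rplus (\<lambda>x. S k x - S n x)"
        by (rule Plancherel_dyadic_step(2)[OF step])
      also have "\<dots> \<le> L2_norm Rplus (\<lambda>x. S k x - F x) + L2_norm Rplus (\<lambda>x. S n x - F x)"
        using L2_norm_diff_triangle[OF Si(2)[of k] F(2) Si(2)[of n]]
        by (simp add: L2_norm_minus_commute[of _ "S n"])
      also have "\<dots> \<le> (1/2) ^ k + (1/2) ^ n"
        using S2[of k] S2[of n] by linarith
      also have "\<dots> \<le> 2 * (1/2) ^ n"
        using power_decreasing[OF that, of "1/2::real"] by linarith
      finally show ?thesis .
    qed
    then show "\<forall>\<^sub>F k in sequentially. L2_norm Rplus (\<lambda>t. ?S k t - ?S n t) \<le> 2 * (1/2) ^ n"
      unfolding eventually_sequentially by blast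
  qed
  have "(\<lambda>n. L2_norm Rplus (?S n)) \<longlonglongrightarrow> L2_norm Rplus ?F"
  proof (rule tendsto_L2_norm[OF TS(1) TF])
    show "(\<lambda>n. L2_norm Rplus (\<lambda>t. ?S n t - ?F t)) \<longlonglongrightarrow> 0"
      by (rule Lim_null_comparison[where g = "\<lambda>n. 2 * (1/2) ^ n"])
        (use dist tendsto_mult_right_zero[OF half] in \<open>auto simp: L2_norm_minus_commute[of _ _ ?F]\<close>)
  qed
  moreover have "(\<lambda>n. L2_norm Rplus (?S n)) \<longlonglongrightarrow> L2_norm Rplus F"
    unfolding TS(2)
  proof (rule tendsto_L2_norm[OF Si(2) F(2)])
    show "(\<lambda>n. L2_norm Rplus (\<lambda>t. S n t - F t)) \<longlonglongrightarrow> 0"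
      by (rule Lim_null_comparison[OF _ half]) (use S2 in \<open>auto intro!: always_eventually less_imp_le\<close>)
  qed
  ultimately show "L2_norm Rplus ?F = L2_norm Rplus F"
    by (rule LIMSEQ_unique)
qed

section \<open>Extension of the transform from L1 \<inter> L2 to L2\<close>

lemma in_L2_iff: "in_L2 f \<longleftrightarrow> square_integrable Rplus f"
  by (simp add: in_L2_def square_integrable_def)

lemma L2_norm_sq_eq: "square_integrable Rplus f \<Longrightarrow> L2_norm_sq f = ennreal ((L2_norm Rplus f)\<^sup>2)"
  unfolding L2_norm_sq_def by (rule nn_integral_norm_sq)

lemma L2_norm_sq_tendsto_0_iff:
  assumes "\<And>n. square_integrable Rplus (F n)"
  shows "(\<lambda>n. L2_norm_sq (F n)) \<longlonglongrightarrow> 0 \<longleftrightarrow> (\<lambda>n. L2_norm Rplus (F n)) \<longlonglongrightarrow> 0"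
proof -
  have "(\<lambda>n. L2_norm_sq (F n)) \<longlonglongrightarrow> 0 \<longleftrightarrow> (\<lambda>n. (L2_norm Rplus (F n))\<^sup>2) \<longlonglongrightarrow> 0"
    by (simp add: L2_norm_sq_eq[OF assms] tendsto_ennreal_iff flip: ennreal_0)
  also have "\<dots> \<longleftrightarrow> (\<lambda>n. L2_norm Rplus (F n)) \<longlonglongrightarrow> 0"
    by (auto dest: tendsto_power[where n = 2] tendsto_real_sqrt)
  finally show ?thesis .
qed

lemma is_walsh_fourier_iff:
  assumes "square_integrable Rplus f"
  shows "is_walsh_fourier f g \<longleftrightarrow> square_integrable Rplus g \<and>
     (\<exists>F. (\<forall>n. integrable Rplus (F n) \<and> square_integrable Rplus (F n)) \<and>
        (\<lambda>n. L2_norm Rplus (\<lambda>x. F n x - f x)) \<longlonglongrightarrow> 0 \<and>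
        (\<lambda>n. L2_norm Rplus (\<lambda>t. walsh_fourier_L1 (F n) t - g t)) \<longlonglongrightarrow> 0)"
  unfolding is_walsh_fourier_def in_L2_iff
proof (intro conj_cong refl ex_cong1)
  fix F :: "nat \<Rightarrow> real \<Rightarrow> complex"
  assume g: "square_integrable Rplus g" and F: "\<forall>n. integrable Rplus (F n) \<and> square_integrable Rplus (F n)"
  show "(\<lambda>n. L2_norm_sq (\<lambda>x. F n x - f x)) \<longlonglongrightarrow> 0 \<longleftrightarrow> (\<lambda>n. L2_norm Rplus (\<lambda>x. F n x - f x)) \<longlonglongrightarrow> 0"
    by (rule L2_norm_sq_tendsto_0_iff) (use F assms in \<open>auto intro: square_integrable_diff\<close>)
  show "(\<lambda>n. L2_norm_sq (\<lambda>t. walsh_fourier_L1 (F n) t - g t)) \<longlonglongrightarrow> 0 \<longleftrightarrow>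
      (\<lambda>n. L2_norm Rplus (\<lambda>t. walsh_fourier_L1 (F n) t - g t)) \<longlonglongrightarrow> 0"
    by (rule L2_norm_sq_tendsto_0_iff) (use F g in \<open>auto intro: square_integrable_diff Plancherel_L1_L2\<close>)
qed

text \<open>Without a witness the choice in \<open>walsh_fourier\<close> would say nothing. The
  approximants are taken at rate \<open>(1/4) ^ n\<close> because
  \<open>L2_complete_geometric\<close> asks for that rate; by Plancherel their transforms inherit it
  up to a factor 2.\<close>

lemma is_walsh_fourier_exists:
  assumes f: "square_integrable Rplus f"
  shows "\<exists>g. is_walsh_fourier f g"
proof -
  have "\<exists>G. integrable Rplus G \<and> square_integrable Rplus G \<and> L2_norm Rplus (\<lambda>x. G x - f x) < (1/4) ^ n" for n :: nat
    using L1_L2_dense_in_L2[OF f, of "(1/4) ^ n"] by auto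
  then obtain G where G: "\<And>n. integrable Rplus (G n)" "\<And>n. square_integrable Rplus (G n)"
    and Gf: "\<And>n. L2_norm Rplus (\<lambda>x. G n x - f x) < (1/4) ^ n"
    by metis
  have step: "L2_norm Rplus (\<lambda>t. walsh_fourier_L1 (G (Suc n)) t - walsh_fourier_L1 (G n) t) \<le> 2 * (1/4) ^ n" for n
  proof -
    have "L2_norm Rplus (\<lambda>t. walsh_fourier_L1 (G (Suc n)) t - walsh_fourier_L1 (G n) t) =
        L2_norm Rplus (walsh_fourier_L1 (\<lambda>x. G (Suc n) x - G n x))"
      unfolding L2_norm_def using walsh_fourier_L1_diff[OF G(1)[of "Suc n"] G(1)[of n]]
      by (intro arg_cong[where f = sqrt] Bochner_Integration.integral_cong) (auto simp: space_restrict_space)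
    also have "\<dots> = L2_norm Rplus (\<lambda>x. G (Suc n) x - G n x)"
      by (intro Plancherel_L1_L2 Bochner_Integration.integrable_diff square_integrable_diff G)
    also have "\<dots> \<le> L2_norm Rplus (\<lambda>x. G (Suc n) x - f x) + L2_norm Rplus (\<lambda>x. G n x - f x)"
      using L2_norm_diff_triangle[OF G(2)[of "Suc n"] f G(2)[of n]]
      by (simp add: L2_norm_minus_commute[of _ "G n"])
    also have "\<dots> \<le> 2 * (1/4) ^ n"
      using Gf[of "Suc n"] Gf[of n] power_decreasing[of n "Suc n" "1/4::real"] by linarith
    finally show ?thesis .
  qed
  obtain g where g: "square_integrable Rplus g" "(\<lambda>n. L2_norm Rplus (\<lambda>t. walsh_fourier_L1 (G n) t - g t)) \<longlonglongrightarrow> 0"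
    by (rule L2_complete_geometric[OF Plancherel_L1_L2(1)[OF G] step])
  have "(\<lambda>n. (1/4::real) ^ n) \<longlonglongrightarrow> 0"
    by (rule LIMSEQ_power_zero) simp
  then have "(\<lambda>n. L2_norm Rplus (\<lambda>x. G n x - f x)) \<longlonglongrightarrow> 0"
    by (rule Lim_null_comparison[rotated]) (use Gf in \<open>auto intro!: always_eventually less_imp_le\<close>)
  then show ?thesis
    using g G by (auto simp: is_walsh_fourier_iff[OF f])
qed

lemma is_walsh_fourier_walsh_fourier:
  "square_integrable Rplus f \<Longrightarrow> is_walsh_fourier f (walsh_fourier f)"
  unfolding walsh_fourier_def by (rule someI_ex[OF is_walsh_fourier_exists])

lemma walsh_fourier_approximation:
  assumes f: "square_integrable Rplus f"
  obtains F where "\<And>n. integrable Rplus (F n)" "\<And>n. square_integrable Rplus (F n)"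
    "(\<lambda>n. L2_norm Rplus (\<lambda>x. F n x - f x)) \<longlonglongrightarrow> 0"
    "(\<lambda>n. L2_norm Rplus (\<lambda>t. walsh_fourier_L1 (F n) t - walsh_fourier f t)) \<longlonglongrightarrow> 0"
  using is_walsh_fourier_walsh_fourier[OF f] unfolding is_walsh_fourier_iff[OF f] by blast

theorem Plancherel_walsh_fourier:
  assumes f: "square_integrable Rplus f"
  shows "square_integrable Rplus (walsh_fourier f)"
    and "L2_norm Rplus (walsh_fourier f) = L2_norm Rplus f"
proof -
  show g: "square_integrable Rplus (walsh_fourier f)"
    using is_walsh_fourier_walsh_fourier[OF f] unfolding is_walsh_fourier_iff[OF f] by blast
  obtain F where F: "\<And>n. integrable Rplus (F n)" "\<And>n. square_integrable Rplus (F n)"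
    and 1: "(\<lambda>n. L2_norm Rplus (\<lambda>x. F n x - f x)) \<longlonglongrightarrow> 0"
    and 2: "(\<lambda>n. L2_norm Rplus (\<lambda>t. walsh_fourier_L1 (F n) t - walsh_fourier f t)) \<longlonglongrightarrow> 0"
    using walsh_fourier_approximation[OF f] by blast
  show "L2_norm Rplus (walsh_fourier f) = L2_norm Rplus f"
    using tendsto_L2_norm[OF F(2) f 1] tendsto_L2_norm[OF Plancherel_L1_L2(1)[OF F] g 2]
    unfolding Plancherel_L1_L2(2)[OF F] by (rule LIMSEQ_unique[rotated])
qed

section \<open>Concentration\<close>

definition restr :: "'a set \<Rightarrow> ('a \<Rightarrow> complex) \<Rightarrow> 'a \<Rightarrow> complex" where
  "restr A f x = (if x \<in> A then f x else 0)"

lemma restr_measurable [measurable]: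
  assumes "A \<in> sets M" "f \<in> borel_measurable M"
  shows "restr A f \<in> borel_measurable M"
  unfolding restr_def using assms by measurable

lemma
  assumes "A \<in> sets M" "square_integrable M f"
  shows square_integrable_restr: "square_integrable M (restr A f)"
    and L2_norm_restr_le: "L2_norm M (restr A f) \<le> L2_norm M f"
  using assms by (auto intro!: square_integrable_mono[of M f] restr_measurable simp: restr_def)

lemma L2_norm_restr_split:
  assumes A: "A \<in> sets M" and f: "square_integrable M f"
  shows "(L2_norm M f)\<^sup>2 = (L2_norm M (restr A f))\<^sup>2 + (L2_norm M (restr (space M - A) f))\<^sup>2"
proof -
  have "(L2_norm M f)\<^sup>2 = (LINT x|M. (cmod (restr A f x))\<^sup>2 + (cmod (restr (space M - A) f x))\<^sup>2)"
    unfolding L2_norm_power2 by (intro Bochner_Integration.integral_cong) (auto simp: restr_def)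
  also have "\<dots> = (L2_norm M (restr A f))\<^sup>2 + (L2_norm M (restr (space M - A) f))\<^sup>2"
    unfolding L2_norm_power2
    by (intro Bochner_Integration.integral_add square_integrable_norm_sq square_integrable_restr f A
        sets.compl_sets)
  finally show ?thesis .
qed

lemma L2_norm_restr_const:
  assumes "A \<in> sets M" "emeasure M A < \<infinity>" "c \<ge> 0"
  shows "square_integrable M (restr A (\<lambda>_. complex_of_real c))"
    and "L2_norm M (restr A (\<lambda>_. complex_of_real c)) = c * sqrt (measure M A)"
proof -
  have eq: "(cmod (restr A (\<lambda>_. complex_of_real c) x))\<^sup>2 = indicator A x *\<^sub>R c\<^sup>2" for x
    by (auto simp: restr_def)
  have "integrable M (\<lambda>x. indicator A x *\<^sub>R c\<^sup>2)"
    using assms by (intro integrable_scaleR_left integrable_real_indicator) auto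
  then show "square_integrable M (restr A (\<lambda>_. complex_of_real c))"
    unfolding square_integrable_def eq using assms(1) by (auto intro!: restr_measurable)
  have "(LINT x|M. indicator A x *\<^sub>R c\<^sup>2) = measure M (A \<inter> space M) * c\<^sup>2"
    by simp
  then show "L2_norm M (restr A (\<lambda>_. complex_of_real c)) = c * sqrt (measure M A)"
    unfolding L2_norm_def eq using assms by (simp add: real_sqrt_mult)
qed

text \<open>Cauchy-Schwarz against the indicator of \<open>A\<close>.\<close>

lemma L1_le_L2_restr:
  assumes A: "A \<in> sets M" "emeasure M A < \<infinity>" and f: "square_integrable M f"
  shows "(LINT x|M. cmod (restr A f x)) \<le> sqrt (measure M A) * L2_norm M f"
proof -
  have "(LINT x|M. cmod (restr A f x)) = (LINT x|M. cmod (restr A (\<lambda>_. complex_of_real 1) x) * cmod (f x))"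
    by (intro Bochner_Integration.integral_cong) (auto simp: restr_def)
  also have "\<dots> \<le> L2_norm M (restr A (\<lambda>_. complex_of_real 1)) * L2_norm M f"
    using A by (intro Cauchy_Schwarz_L2 L2_norm_restr_const f) auto
  also have "L2_norm M (restr A (\<lambda>_. complex_of_real 1)) = sqrt (measure M A)"
    using L2_norm_restr_const(2)[OF A, of 1] by simp
  finally show ?thesis .
qed

text \<open>The two parts of \<open>F\<close> are measured differently. The part on \<open>A\<close>
  has small \<open>L1\<close> norm, hence a transform bounded in the supremum norm, which costs
  \<open>sqrt (measure Rplus B)\<close> on \<open>B\<close>. The part off \<open>A\<close> is
  controlled by Plancherel alone.\<close>

lemma concentration_L1_L2:
  assumes F: "integrable Rplus F" "square_integrable Rplus F"
    and A: "A \<in> sets Rplus" "emeasure Rplus A < \<infinity>" and B: "B \<in> sets Rplus" "emeasure Rplus B < \<infinity>"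
  shows "L2_norm Rplus (restr B (walsh_fourier_L1 F)) \<le>
     sqrt (measure Rplus A * measure Rplus B) * L2_norm Rplus F + L2_norm Rplus (restr (space Rplus - A) F)"
proof -
  let ?A' = "space Rplus - A"
  define F1 where "F1 = restr A F"
  define F2 where "F2 = restr ?A' F"
  have A': "?A' \<in> sets Rplus" using A(1) by (rule sets.compl_sets)
  have m: "F1 \<in> borel_measurable Rplus" "F2 \<in> borel_measurable Rplus"
    using F(2) A(1) A' by (auto simp: F1_def F2_def intro!: restr_measurable)
  have i1: "integrable Rplus F1" and i2: "integrable Rplus F2"
    by (rule Bochner_Integration.integrable_bound[OF F(1)], use m in \<open>auto simp: F1_def F2_def restr_def\<close>)+
  have s: "square_integrable Rplus F1" "square_integrable Rplus F2"
    using A(1) A' F(2) by (auto simp: F1_def F2_def intro: square_integrable_restr)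
  let ?c = "sqrt (measure Rplus A) * L2_norm Rplus F"
  have T1: "square_integrable Rplus (walsh_fourier_L1 F1)" and T2: "square_integrable Rplus (walsh_fourier_L1 F2)"
    by (intro Plancherel_L1_L2 i1 i2 s)+
  have eq: "walsh_fourier_L1 F t = walsh_fourier_L1 F1 t + walsh_fourier_L1 F2 t" if "t \<in> space Rplus" for t
  proof -
    have t: "t \<ge> 0" using that by (simp add: space_restrict_space)
    have "walsh_fourier_L1 F2 t = walsh_fourier_L1 (\<lambda>x. F x - F1 x) t"
      unfolding walsh_fourier_L1_def
      by (intro Bochner_Integration.integral_cong) (auto simp: F1_def F2_def restr_def)
    then show ?thesis
      using walsh_fourier_L1_diff[OF F(1) i1 t] by simp
  qed
  have "L2_norm Rplus (restr B (walsh_fourier_L1 F)) =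
      L2_norm Rplus (\<lambda>t. restr B (walsh_fourier_L1 F1) t + restr B (walsh_fourier_L1 F2) t)"
    unfolding L2_norm_def using eq
    by (intro arg_cong[where f = sqrt] Bochner_Integration.integral_cong) (auto simp: restr_def)
  also have "\<dots> \<le> L2_norm Rplus (restr B (walsh_fourier_L1 F1)) + L2_norm Rplus (restr B (walsh_fourier_L1 F2))"
    by (intro Minkowski_L2 square_integrable_restr B T1 T2)
  \<comment> \<open>The supremum bound is expressed as domination by a constant on \<open>B\<close>,
    so that monotonicity of the norm applies.\<close>
  also have "L2_norm Rplus (restr B (walsh_fourier_L1 F1)) \<le> L2_norm Rplus (restr B (\<lambda>_. complex_of_real ?c))"
  proof (rule square_integrable_mono(2))
    show "square_integrable Rplus (restr B (\<lambda>_. complex_of_real ?c))"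
      by (intro L2_norm_restr_const B) simp
    show "restr B (walsh_fourier_L1 F1) \<in> borel_measurable Rplus"
      using T1 B(1) by (auto intro!: restr_measurable)
    have "cmod (walsh_fourier_L1 F1 t) \<le> ?c" if "t \<ge> 0" for t
      using norm_walsh_fourier_L1_le[OF i1 that] L1_le_L2_restr[OF A F(2)] by (simp add: F1_def)
    then show "AE t in Rplus. cmod (restr B (walsh_fourier_L1 F1) t) \<le> cmod (restr B (\<lambda>_. complex_of_real ?c) t)"
      by (intro AE_I2) (auto simp: restr_def space_restrict_space norm_mult)
  qed
  also have "L2_norm Rplus (restr B (\<lambda>_. complex_of_real ?c)) = ?c * sqrt (measure Rplus B)"
    by (intro L2_norm_restr_const B) simp
  also have "L2_norm Rplus (restr B (walsh_fourier_L1 F2)) \<le> L2_norm Rplus (walsh_fourier_L1 F2)"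
    by (intro L2_norm_restr_le B T2)
  also have "\<dots> = L2_norm Rplus (restr ?A' F)"
    using Plancherel_L1_L2(2)[OF i2 s(2)] by (simp add: F2_def)
  finally show ?thesis
    by (simp add: real_sqrt_mult mult_ac)
qed

text \<open>Each term is continuous in the \<open>L2\<close> norm, because restriction to a set is a
  contraction; the inequality therefore survives the limit that defines the transform.\<close>

lemma concentration_L2:
  assumes f: "square_integrable Rplus f"
    and A: "A \<in> sets Rplus" "emeasure Rplus A < \<infinity>" and B: "B \<in> sets Rplus" "emeasure Rplus B < \<infinity>"
  shows "L2_norm Rplus (restr B (walsh_fourier f)) \<le>
     sqrt (measure Rplus A * measure Rplus B) * L2_norm Rplus f + L2_norm Rplus (restr (space Rplus - A) f)"
proof -
  let ?A' = "space Rplus - A"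
  have A': "?A' \<in> sets Rplus" using A(1) by (rule sets.compl_sets)
  note g = Plancherel_walsh_fourier(1)[OF f]
  obtain F where F: "\<And>n. integrable Rplus (F n)" "\<And>n. square_integrable Rplus (F n)"
    and 1: "(\<lambda>n. L2_norm Rplus (\<lambda>x. F n x - f x)) \<longlonglongrightarrow> 0"
    and 2: "(\<lambda>n. L2_norm Rplus (\<lambda>t. walsh_fourier_L1 (F n) t - walsh_fourier f t)) \<longlonglongrightarrow> 0"
    using walsh_fourier_approximation[OF f] by blast
  have restr_tendsto: "(\<lambda>n. L2_norm Rplus (restr C (G n))) \<longlonglongrightarrow> L2_norm Rplus (restr C h)"
    if C: "C \<in> sets Rplus" and G: "\<And>n. square_integrable Rplus (G n)" and h: "square_integrable Rplus h"
      and lim: "(\<lambda>n. L2_norm Rplus (\<lambda>x. G n x - h x)) \<longlonglongrightarrow> 0" for C G h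
  proof (rule tendsto_L2_norm)
    have "L2_norm Rplus (\<lambda>x. restr C (G n) x - restr C h x) \<le> L2_norm Rplus (\<lambda>x. G n x - h x)" for n
    proof -
      have "(\<lambda>x. restr C (G n) x - restr C h x) = restr C (\<lambda>x. G n x - h x)"
        by (auto simp: restr_def)
      then show ?thesis
        using L2_norm_restr_le[OF C square_integrable_diff[OF G[of n] h]] by simp
    qed
    then show "(\<lambda>n. L2_norm Rplus (\<lambda>x. restr C (G n) x - restr C h x)) \<longlonglongrightarrow> 0"
      by (intro Lim_null_comparison[OF _ lim]) simp
  qed (use C G h in \<open>auto intro: square_integrable_restr\<close>)
  show ?thesis
  proof (rule LIMSEQ_le)
    show "(\<lambda>n. L2_norm Rplus (restr B (walsh_fourier_L1 (F n)))) \<longlonglongrightarrow> L2_norm Rplus (restr B (walsh_fourier f))"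
      by (rule restr_tendsto[OF B(1) Plancherel_L1_L2(1)[OF F] g 2])
    show "(\<lambda>n. sqrt (measure Rplus A * measure Rplus B) * L2_norm Rplus (F n) + L2_norm Rplus (restr ?A' (F n)))
        \<longlonglongrightarrow> sqrt (measure Rplus A * measure Rplus B) * L2_norm Rplus f + L2_norm Rplus (restr ?A' f)"
      by (intro tendsto_add tendsto_mult_left tendsto_L2_norm[OF F(2) f 1] restr_tendsto[OF A' F(2) f 1])
    show "\<exists>N. \<forall>n\<ge>N. L2_norm Rplus (restr B (walsh_fourier_L1 (F n))) \<le>
        sqrt (measure Rplus A * measure Rplus B) * L2_norm Rplus (F n) + L2_norm Rplus (restr ?A' (F n))"
      using concentration_L1_L2[OF F A B] by blast
  qed
qed

text \<open>Stated with the ordinary distance, so that the complement is an interval of known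
  length. The threshold \<open>4 / 25\<close> is the square of \<open>2 / 5\<close>, which makes the
  norm of the outer part rational in the norm of \<open>h\<close>.\<close>

definition concentrated :: "(real \<Rightarrow> complex) \<Rightarrow> real \<Rightarrow> bool" where
  "concentrated h r \<longleftrightarrow> (\<exists>y\<ge>0. (L2_norm Rplus (restr {x \<in> space Rplus. \<bar>x - y\<bar> \<ge> r} h))\<^sup>2
     \<le> 4 / 25 * (L2_norm Rplus h)\<^sup>2)"

text \<open>The length is only bounded above, since the interval may be cut off at 0.\<close>

lemma Rplus_interval:
  fixes r y :: real
  assumes "r > 0"
  defines "A \<equiv> {x \<in> space Rplus. \<bar>x - y\<bar> < r}"
  shows "A \<in> sets Rplus" "emeasure Rplus A < \<infinity>" "measure Rplus A \<le> 2 * r"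
    and "space Rplus - A = {x \<in> space Rplus. \<bar>x - y\<bar> \<ge> r}"
proof -
  show A: "A \<in> sets Rplus" unfolding A_def by measurable
  have "emeasure Rplus A = emeasure lebesgue A"
    using A by (intro emeasure_restrict_space) (auto simp: space_restrict_space A_def)
  also have "\<dots> \<le> emeasure lebesgue {y - r<..<y + r}"
    by (intro emeasure_mono) (auto simp: A_def)
  also have "\<dots> = ennreal (2 * r)"
    using assms by simp
  finally have *: "emeasure Rplus A \<le> ennreal (2 * r)" .
  then show "emeasure Rplus A < \<infinity>"
    by (simp add: le_less_trans)
  show "measure Rplus A \<le> 2 * r"
    unfolding measure_def using enn2real_mono[OF *] assms by simp
  show "space Rplus - A = {x \<in> space Rplus. \<bar>x - y\<bar> \<ge> r}"
    by (auto simp: A_def)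
qed

lemma concentrated_product:
  assumes f: "square_integrable Rplus f" "L2_norm Rplus f > 0"
    and r: "r > 0" "concentrated f r" and q: "q > 0" "concentrated (walsh_fourier f) q"
  shows "r * q > 65 / 1000"
proof -
  define S where "S = L2_norm Rplus f"
  have S: "S > 0" using f by (simp add: S_def)
  note g = Plancherel_walsh_fourier[OF f(1)]
  obtain y where y: "(L2_norm Rplus (restr {x \<in> space Rplus. \<bar>x - y\<bar> \<ge> r} f))\<^sup>2 \<le> 4 / 25 * S\<^sup>2"
    using r(2) by (auto simp: concentrated_def S_def)
  obtain z where z: "(L2_norm Rplus (restr {x \<in> space Rplus. \<bar>x - z\<bar> \<ge> q} (walsh_fourier f)))\<^sup>2 \<le> 4 / 25 * S\<^sup>2"
    using q(2) by (auto simp: concentrated_def S_def g(2))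
  define A where "A = {x \<in> space Rplus. \<bar>x - y\<bar> < r}"
  define B where "B = {x \<in> space Rplus. \<bar>x - z\<bar> < q}"
  note A = Rplus_interval[OF r(1), of y, folded A_def] and B = Rplus_interval[OF q(1), of z, folded B_def]
  have "(L2_norm Rplus (restr (space Rplus - A) f))\<^sup>2 \<le> (2 / 5 * S)\<^sup>2"
    using y unfolding A(4) by (simp add: power2_eq_square)
  then have 1: "L2_norm Rplus (restr (space Rplus - A) f) \<le> 2 / 5 * S"
    by (rule power2_le_imp_le) (use S in simp)
  have "S\<^sup>2 \<le> (L2_norm Rplus (restr B (walsh_fourier f)))\<^sup>2 + 4 / 25 * S\<^sup>2"
    using L2_norm_restr_split[OF B(1) g(1)] z unfolding B(4) g(2) S_def[symmetric] by linarith
  \<comment> \<open>A rational lower bound for \<open>sqrt (1 - 4/25)\<close>: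
    \<open>8281 / 10000\<close> lies just under \<open>21 / 25\<close>. Subtracting the outer part
    \<open>2 / 5\<close> leaves \<open>51 / 100\<close>, and a quarter of its square is
    \<open>0.065025\<close>.\<close>
  moreover have "(91 / 100 * S)\<^sup>2 = 8281 / 10000 * S\<^sup>2"
    by (simp add: power2_eq_square)
  moreover have "S\<^sup>2 > 0"
    using S by simp
  ultimately have "(91 / 100 * S)\<^sup>2 \<le> (L2_norm Rplus (restr B (walsh_fourier f)))\<^sup>2"
    by linarith
  then have 2: "91 / 100 * S \<le> L2_norm Rplus (restr B (walsh_fourier f))"
    by (rule power2_le_imp_le) simp
  have "91 / 100 * S \<le> sqrt (measure Rplus A * measure Rplus B) * S + 2 / 5 * S"
    using concentration_L2[OF f(1) A(1,2) B(1,2), folded S_def] 1 2 by linarith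
  then have "(51 / 100) * S \<le> sqrt (measure Rplus A * measure Rplus B) * S"
    by linarith
  then have "51 / 100 \<le> sqrt (measure Rplus A * measure Rplus B)"
    using S by simp
  then have "(51 / 100)\<^sup>2 \<le> (sqrt (measure Rplus A * measure Rplus B))\<^sup>2"
    by (rule power_mono) simp
  also have "\<dots> = measure Rplus A * measure Rplus B"
    by simp
  also have "\<dots> \<le> (2 * r) * (2 * q)"
    using A(3) B(3) r(1) by (intro mult_mono) auto
  finally show ?thesis
    by (simp add: power2_eq_square)
qed

text \<open>Needed when the other function of the pair has variance 0: some finite radius must then
  be available here even if this variance is infinite. It comes from the vanishing of
  \<open>L2\<close> tails.\<close>

lemma concentrated_exists:
  assumes h: "square_integrable Rplus h" "L2_norm Rplus h > 0"
  obtains r where "r > 0" "concentrated h r"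
proof -
  let ?R = "\<lambda>n::nat. restr {x \<in> space Rplus. \<bar>x - 0\<bar> \<ge> 1 + real n} h"
  have "(\<lambda>n. L2_norm Rplus (\<lambda>x. ?R n x - 0)) \<longlonglongrightarrow> 0"
  proof (rule dominated_convergence_L2)
    have "{x \<in> space Rplus. \<bar>x - 0\<bar> \<ge> 1 + real n} \<in> sets Rplus" for n
      by measurable
    then show "?R n \<in> borel_measurable Rplus" for n
      using h(1) by (auto intro!: restr_measurable)
    show "integrable Rplus (\<lambda>x. (cmod (h x))\<^sup>2)" using h(1) by auto
    show "AE x in Rplus. cmod (?R n x) \<le> cmod (h x)" for n
      by (simp add: restr_def)
    show "AE x in Rplus. (\<lambda>n. ?R n x) \<longlonglongrightarrow> 0"
    proof (intro AE_I2 tendsto_eventually)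
      fix x :: real
      obtain n0 :: nat where n0: "\<bar>x\<bar> \<le> real n0" using real_arch_simple by blast
      then have "?R n x = 0" if "n0 \<le> n" for n
        using that by (simp add: restr_def)
      then show "\<forall>\<^sub>F n in sequentially. ?R n x = 0"
        unfolding eventually_sequentially by blast
    qed
  qed simp
  then have "(\<lambda>n. L2_norm Rplus (?R n)) \<longlonglongrightarrow> 0"
    by (simp only: diff_zero)
  moreover have "2 / 5 * L2_norm Rplus h > 0"
    using h(2) by simp
  ultimately have "\<forall>\<^sub>F n in sequentially. L2_norm Rplus (?R n) < 2 / 5 * L2_norm Rplus h"
    by (rule order_tendstoD(2))
  then obtain n where "L2_norm Rplus (?R n) < 2 / 5 * L2_norm Rplus h"
    unfolding eventually_sequentially by blast
  then have "(L2_norm Rplus (?R n))\<^sup>2 \<le> (2 / 5 * L2_norm Rplus h)\<^sup>2"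
    by (intro power_mono) auto
  then have "concentrated h (1 + real n)"
    unfolding concentrated_def by (intro exI[of _ 0]) (simp add: power_mult_distrib power2_eq_square)
  then show ?thesis
    by (intro that[of "1 + real n"]) simp
qed

section \<open>Chebyshev's inequality in the dyadic metric and the final bound\<close>

lemma abs_diff_le_dyadic_sum:
  assumes "x \<ge> 0" "y \<ge> 0"
  shows "\<bar>x - y\<bar> \<le> x \<oplus> y"
proof -
  \<comment> \<open>Digitwise, \<open>a_j \<le> b_j + \<bar>a_j - b_j\<bar>\<close>; the weighted
    sum gives one half of the bound and symmetry the other.\<close>
  have le: "a \<le> b + (a \<oplus> b)" if "a \<ge> 0" "b \<ge> 0" for a b
  proof (rule has_sum_mono)
    let ?w = "\<lambda>j::int. 2 powi (- j - 1) :: real"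
    show "((\<lambda>j. real (dyadic_digit a j) * ?w j) has_sum a) UNIV"
      using that(1) by (rule dyadic_digit_has_sum)
    show "((\<lambda>j. real (dyadic_digit b j) * ?w j + \<bar>real (dyadic_digit a j) - real (dyadic_digit b j)\<bar> * ?w j)
        has_sum (b + (a \<oplus> b))) UNIV"
      unfolding dyadic_sum_def
      by (intro has_sum_add dyadic_digit_has_sum has_sum_infsum dyadic_sum_summable that)
    show "real (dyadic_digit a j) * ?w j \<le> real (dyadic_digit b j) * ?w j +
        \<bar>real (dyadic_digit a j) - real (dyadic_digit b j)\<bar> * ?w j" for j
      unfolding distrib_right[symmetric] by (intro mult_right_mono) auto
  qed
  have "y \<oplus> x = x \<oplus> y"
    by (simp add: dyadic_sum_def abs_minus_commute)
  then show ?thesis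
    using le[OF assms] le[OF assms(2,1)] by linarith
qed

text \<open>Chebyshev's inequality around a suitable centre. The hypothesis is strict because the
  infimum over centres need not be attained.\<close>

lemma dyadic_variance_less_imp_concentrated:
  assumes h: "square_integrable Rplus h" "L2_norm Rplus h > 0" and r: "r > 0"
    and less: "dyadic_variance h < ennreal (4 / 25 * r\<^sup>2)"
  shows "concentrated h r"
proof -
  define S where "S = L2_norm Rplus h"
  have S: "S > 0" using h by (simp add: S_def)
  let ?I = "\<lambda>y. \<integral>\<^sup>+ x. ennreal ((x \<oplus> y)\<^sup>2 * (cmod (h x))\<^sup>2) \<partial>Rplus"
  define J where "J = (INF y\<in>{0..}. ?I y)"
  have "J / ennreal (S\<^sup>2) < ennreal (4 / 25 * r\<^sup>2)"
    using less unfolding dyadic_variance_def L2_norm_sq_eq[OF h(1)] S_def J_def .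
  then have "J / ennreal (S\<^sup>2) * ennreal (S\<^sup>2) < ennreal (4 / 25 * r\<^sup>2) * ennreal (S\<^sup>2)"
    using S by (intro ennreal_mult_strict_right_mono) auto
  also have "J / ennreal (S\<^sup>2) * ennreal (S\<^sup>2) = J"
    using S by (simp add: ennreal_divide_times mult_divide_eq_ennreal)
  also have "ennreal (4 / 25 * r\<^sup>2) * ennreal (S\<^sup>2) = ennreal (4 / 25 * r\<^sup>2 * S\<^sup>2)"
    by (rule ennreal_mult'[symmetric]) simp
  finally have "(INF y\<in>{0..}. ?I y) < ennreal (4 / 25 * r\<^sup>2 * S\<^sup>2)"
    unfolding J_def .
  \<comment> \<open>Strictness yields a centre whose integral lies below the threshold although it
    may fail to be minimal.\<close>
  then obtain y where y: "y \<ge> 0" "?I y < ennreal (4 / 25 * r\<^sup>2 * S\<^sup>2)"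
    by (auto simp: INF_less_iff)
  let ?T = "{x \<in> space Rplus. \<bar>x - y\<bar> \<ge> r}"
  have "?T \<in> sets Rplus" by measurable
  then have si: "square_integrable Rplus (restr ?T h)"
    by (rule square_integrable_restr[OF _ h(1)])
  have "ennreal (r\<^sup>2 * (L2_norm Rplus (restr ?T h))\<^sup>2) =
      (\<integral>\<^sup>+ x. ennreal (r\<^sup>2) * ennreal ((cmod (restr ?T h x))\<^sup>2) \<partial>Rplus)"
    using si by (subst nn_integral_cmult) (auto simp: nn_integral_norm_sq ennreal_mult')
  also have "\<dots> \<le> ?I y"
  proof (rule nn_integral_mono)
    fix x assume x: "x \<in> space Rplus"
    have "r\<^sup>2 * (cmod (restr ?T h x))\<^sup>2 \<le> (x \<oplus> y)\<^sup>2 * (cmod (h x))\<^sup>2"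
    proof (cases "x \<in> ?T")
      case True
      then have "r \<le> x \<oplus> y"
        using abs_diff_le_dyadic_sum[of x y] y(1) by (simp add: space_restrict_space)
      then have "r\<^sup>2 \<le> (x \<oplus> y)\<^sup>2"
        using r by (intro power_mono) auto
      then show ?thesis
        using True by (simp add: restr_def mult_right_mono)
    qed (auto simp: restr_def)
    then show "ennreal (r\<^sup>2) * ennreal ((cmod (restr ?T h x))\<^sup>2) \<le> ennreal ((x \<oplus> y)\<^sup>2 * (cmod (h x))\<^sup>2)"
      by (simp add: ennreal_leI flip: ennreal_mult')
  qed
  also note y(2)
  finally have "r\<^sup>2 * (L2_norm Rplus (restr ?T h))\<^sup>2 < 4 / 25 * r\<^sup>2 * S\<^sup>2"
    using r by (subst (asm) ennreal_less_iff) auto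
  then have "(L2_norm Rplus (restr ?T h))\<^sup>2 \<le> 4 / 25 * S\<^sup>2"
    using r by (simp add: mult.left_commute)
  then show ?thesis
    unfolding concentrated_def using y(1) by (auto simp: S_def)
qed

theorem dyadic_uncertainty:
  assumes f: "square_integrable Rplus f" "L2_norm Rplus f > 0"
  shows "ennreal (8.5 / 10 ^ 5) \<le> UC_d f"
proof -
  let ?g = "walsh_fourier f"
  let ?v = "dyadic_variance f" and ?w = "dyadic_variance ?g"
  note g = Plancherel_walsh_fourier[OF f(1)]
  have g0: "L2_norm Rplus ?g > 0" using f(2) g(2) by simp
  \<comment> \<open>Variance 0 would make \<open>f\<close> concentrated at every positive radius, in
    particular at one far too small for whatever radius the transform has.\<close>
  have v0: "?v \<noteq> 0"
  proof
    assume v: "?v = 0"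
    obtain q where q: "q > 0" "concentrated ?g q"
      by (rule concentrated_exists[OF g(1) g0])
    \<comment> \<open>Chosen so that the two radii multiply to \<open>6 / 100\<close>, below the
      bound \<open>65 / 1000\<close> of \<open>concentrated_product\<close>.\<close>
    have r: "6 / 100 / q > 0" using q(1) by simp
    have "concentrated f (6 / 100 / q)"
      using r by (intro dyadic_variance_less_imp_concentrated f) (auto simp: v)
    from concentrated_product[OF f r this q] show False
      using q(1) by simp
  qed
  have w0: "?w \<noteq> 0"
  proof
    assume w: "?w = 0"
    obtain r where r: "r > 0" "concentrated f r"
      by (rule concentrated_exists[OF f])
    have q: "6 / 100 / r > 0" using r(1) by simp
    have "concentrated ?g (6 / 100 / r)"
      using q by (intro dyadic_variance_less_imp_concentrated g g0) (auto simp: w)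
    from concentrated_product[OF f r q this] show False
      using r(1) by simp
  qed
  show ?thesis
  proof (cases "?v = \<infinity> \<or> ?w = \<infinity>")
    case True
    then have "UC_d f = \<infinity>"
      using v0 w0 by (auto simp: UC_d_def ennreal_mult_eq_top_iff)
    then show ?thesis by simp
  next
    case False
    then obtain a b where a: "?v = ennreal a" "a \<ge> 0" and b: "?w = ennreal b" "b \<ge> 0"
      by (cases ?v; cases ?w) auto
    with v0 w0 have pos: "a > 0" "b > 0" by auto
    \<comment> \<open>The critical factor is \<open>25 / 4 = 100 / 16\<close>, at which
      \<open>4 / 25 * r^2\<close> equals the variance. Five percent more makes the inequality
      strict, as Chebyshev's lemma demands.\<close>
    define r where "r = sqrt (105 / 16 * a)"
    define q where "q = sqrt (105 / 16 * b)"
    have rq: "r > 0" "q > 0" "r\<^sup>2 = 105 / 16 * a" "q\<^sup>2 = 105 / 16 * b"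
      using pos by (auto simp: r_def q_def)
    have "concentrated f r"
      using rq pos a by (intro dyadic_variance_less_imp_concentrated f) (auto simp: ennreal_less_iff)
    moreover have "concentrated ?g q"
      using rq pos b by (intro dyadic_variance_less_imp_concentrated g g0) (auto simp: ennreal_less_iff)
    ultimately have "65 / 1000 < r * q"
      using concentrated_product[OF f rq(1) _ rq(2)] by blast
    then have "(65 / 1000)\<^sup>2 < (r * q)\<^sup>2"
      by (intro power_strict_mono) auto
    also have "(r * q)\<^sup>2 = 11025 / 256 * (a * b)"
      by (simp add: power_mult_distrib rq)
    \<comment> \<open>The bound obtained is \<open>(65 / 1000)^2 * 256 / 11025\<close>, about
      9.8e-5.\<close>
    finally have "8.5 / 10 ^ 5 \<le> a * b"
      by (simp add: power2_eq_square)
    then show ?thesis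
      using pos by (simp add: UC_d_def a b ennreal_leI flip: ennreal_mult')
  qed
qed

theorem theorem1:
  "\<exists>C::real. \<bar>C - 8.5 / 10 ^ 5\<bar> \<le> 0.05 / 10 ^ 5 \<and>
     (\<forall>f. in_L2 f \<and> \<not> (AE x in Rplus. f x = 0) \<longrightarrow> ennreal C \<le> UC_d f)"
proof (intro exI[of _ "8.5 / 10 ^ 5"] conjI allI impI)
  fix f assume f: "in_L2 f \<and> \<not> (AE x in Rplus. f x = 0)"
  then have sf: "square_integrable Rplus f"
    by (simp add: in_L2_iff)
  have "(LINT x|Rplus. (cmod (f x))\<^sup>2) \<noteq> 0"
    using f sf by (subst integral_nonneg_eq_0_iff_AE) auto
  then have "L2_norm Rplus f \<noteq> 0"
    by (simp add: L2_norm_def)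
  then have "L2_norm Rplus f > 0"
    using L2_norm_nonneg[of Rplus f] by linarith
  with sf show "ennreal (8.5 / 10 ^ 5) \<le> UC_d f"
    by (rule dyadic_uncertainty)
qed simp

end
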